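(* In the setting of the context, let $\theta>0$ with $E[T^{-\theta}|\rho,\eta]<\infty$. Let $f_1,\dots,f_q$ be real-valued functions on $\mathcal{Y}$, $z_1,\dots,z_q$ non-negative scalars, and put $Pf_l=\int_{\mathcal{Y}}f_l(y)P(dy)$. Then $$\int\Big(1+\sum_{l=1}^qz_lPf_l\Big)^{-\theta}\tilde{\mathcal{P}}(dP|\rho,\eta,\theta)=\mathcal{L}_{V\mu_V}\Big(\sum_{l=1}^qz_lf_l\Big|\rho,\eta,\theta\Big),$$ where $$\mathcal{L}_{V\mu_V}\Big(\sum_{l=1}^qz_lf_l\Big|\rho,\eta,\theta\Big)=\int_0^\infty\mathcal{L}_\mu\Big(v\sum_{l=1}^qz_lf_l\Big|e^{-vh}\rho,\eta\Big)\pi_\theta(dv|\rho,\eta).$$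
   Context: $\mathcal{S},\mathcal{Y}$ are Polish spaces; $\eta$ is a $\sigma$-finite non-atomic measure on $\mathcal{Y}$; $\rho(ds|y)$ is a Lévy measure on $\mathcal{S}$ depending on $y\in\mathcal{Y}$; $h$ is a strictly positive function on $\mathcal{S}$. $N$ is a Poisson random measure on $\mathcal{S}\times\mathcal{Y}$ with intensity $\rho(ds|y)\eta(dy)$, with law $\mathcal{P}(dN|\rho,\eta)$ and expectation $E[\cdot|\rho,\eta]$; $\mu(dy)=\int_{\mathcal{S}}h(s)N(ds,dy)$; $T=\mu(\mathcal{Y})$ is almost surely finite; $P=\mu/T$. $\tilde{\mathcal{P}}(dP|\rho,\eta,\theta)$ is the law of $P$ when $N$ has law $T^{-\theta}\mathcal{P}(dN|\rho,\eta)/E[T^{-\theta}|\rho,\eta]$. $e^{-vh}\rho$ is the kernel $e^{-vh(s)}\rho(ds|y)$, and $\mathcal{L}_\mu(g|\rho,\eta)=E[e^{-\mu(g)}|\rho,\eta]=\exp(-\int_{\mathcal{Y}}\int_{\mathcal{S}}(1-e^{-g(y)h(s)})\rho(ds|y)\eta(dy))$. $\pi_\theta(dv|\rho,\eta)=\frac{v^{\theta-1}E[e^{-vT}|\rho,\eta]dv}{\Gamma(\theta)E[T^{-\theta}|\rho,\eta]}$ on $(0,\infty)$. $\mathcal{L}_{V\mu_V}$ is thus the Laplace functional of $V\mu_V$, where $V\sim\pi_\theta$ and, given $V=v$, $\mu_V$ has the law of $\mu$ with $\rho$ replaced by $e^{-vh}\rho$. *)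

theory Defs
  imports "HOL-Probability.Probability"
begin

section \<open>Random measures\<close>

text \<open>
  The space of all measures on the measurable space \<open>K\<close>, with the sigma-algebra generated by the
  evaluations.  It is built like \<^const>\<open>subprob_algebra\<close>, but without a bound on the total mass.
\<close>
definition measure_algebra :: "'a measure \<Rightarrow> 'a measure measure" where
  "measure_algebra K =
     (SUP A\<in>sets K. vimage_algebra {m. sets m = sets K} (\<lambda>m. emeasure m A) borel)"

text \<open>
  A Poisson random measure \<open>N\<close> with intensity \<open>L\<close>, defined on the probability space \<open>M\<close>.
  Independence is required along disjoint sequences; finite disjoint families are covered by
  padding with the empty set.
\<close>
definition poisson_random_measure ::
  "'w measure \<Rightarrow> ('w \<Rightarrow> 'a measure) \<Rightarrow> 'a measure \<Rightarrow> bool" where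
  "poisson_random_measure M N L \<longleftrightarrow>
     prob_space M \<and>
     N \<in> M \<rightarrow>\<^sub>M measure_algebra L \<and>
     (\<forall>A\<in>sets L. emeasure L A < \<infinity> \<longrightarrow>
        (\<forall>k::nat. measure M {w \<in> space M. emeasure (N w) A = of_nat k}
                   = exp (- measure L A) * measure L A ^ k / fact k)) \<and>
     (\<forall>A\<in>sets L. emeasure L A = \<infinity> \<longrightarrow> (AE w in M. emeasure (N w) A = \<infinity>)) \<and>
     (\<forall>A::nat \<Rightarrow> 'a set. disjoint_family A \<and> range A \<subseteq> sets L \<longrightarrow>
        prob_space.indep_vars M (\<lambda>_. borel) (\<lambda>i w. emeasure (N w) (A i)) UNIV)"

text \<open>
  The law of a Poisson random measure with intensity \<open>L\<close>.  It is determined by \<open>L\<close>, and it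
  exists whenever \<open>L\<close> is sigma-finite.
\<close>
definition poisson_law :: "'a measure \<Rightarrow> 'a measure measure" where
  "poisson_law L =
     (THE Q. sets Q = sets (measure_algebra L) \<and> poisson_random_measure Q (\<lambda>n. n) L)"

section \<open>Extended-real conventions\<close>

text \<open>
  The integral of a real function as an extended real; it is meaningful as soon as the positive
  or the negative part is integrable.
\<close>
definition ext_integral :: "'a measure \<Rightarrow> ('a \<Rightarrow> real) \<Rightarrow> ereal" where
  "ext_integral m g =
     enn2ereal (\<integral>\<^sup>+ y. ennreal (g y) \<partial>m) - enn2ereal (\<integral>\<^sup>+ y. ennreal (- g y) \<partial>m)"

text \<open>The function $x \mapsto e^{-x}$ on the extended reals.\<close>
definition exp_neg :: "ereal \<Rightarrow> ennreal" where
  "exp_neg x =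
     (if x = \<infinity> then 0 else if x = -\<infinity> then \<infinity> else ennreal (exp (- real_of_ereal x)))"

text \<open>
  The function $x \mapsto x^{-\theta}$ on the extended reals, for $\theta > 0$.  For $x \le 0$ it is
  infinite, so that
  $x^{-\theta} = \Gamma(\theta)^{-1} \int_0^\infty v^{\theta-1} e^{-vx}\,dv$ for every $x$.
\<close>
definition neg_power :: "real \<Rightarrow> ereal \<Rightarrow> ennreal" where
  "neg_power \<theta> x =
     (if x \<le> 0 then \<infinity> else if x = \<infinity> then 0 else ennreal (real_of_ereal x powr (- \<theta>)))"

text \<open>The Laplace functional $g \mapsto E[e^{-m(g)}]$ of a random measure $m$ with law \<open>Q\<close>.\<close>
definition laplace_functional :: "'a measure measure \<Rightarrow> ('a \<Rightarrow> real) \<Rightarrow> ennreal" where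
  "laplace_functional Q g = (\<integral>\<^sup>+ m. exp_neg (ext_integral m g) \<partial>Q)"

section \<open>The measures $\rho$ and $\eta$\<close>

definition non_atomic :: "'a measure \<Rightarrow> bool" where
  "non_atomic M \<longleftrightarrow>
     \<not> (\<exists>A\<in>sets M. emeasure M A > 0 \<and>
          (\<forall>B\<in>sets M. B \<subseteq> A \<longrightarrow> emeasure M B = 0 \<or> emeasure M (A - B) = 0))"

text \<open>
  A measurable family $\rho(ds|y)$ of Levy measures.  A general Polish space has no distinguished
  point at which the mass may accumulate, so \<open>\<rho>(\<cdot>|y)\<close> is required to be finite on each member
  of a countable measurable cover (for $(0,\infty)$: the sets $(1/k,\infty)$) not depending on \<open>y\<close>.
  The integrability of $\min(1,h)$ under $\rho(ds|y)\eta(dy)$ is equivalent to almost sure finiteness of the total mass \<open>T\<close>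
  below, which is assumed where it is needed.
\<close>
definition levy_kernel :: "('y::topological_space \<Rightarrow> 's::topological_space measure) \<Rightarrow> bool" where
  "levy_kernel \<rho> \<longleftrightarrow>
     (\<forall>y. sets (\<rho> y) = sets borel) \<and>
     (\<forall>B\<in>sets borel. (\<lambda>y. emeasure (\<rho> y) B) \<in> borel_measurable borel) \<and>
     (\<exists>C::nat \<Rightarrow> 's set. range C \<subseteq> sets borel \<and> (\<Union>k. C k) = UNIV \<and>
        (\<forall>k y. emeasure (\<rho> y) (C k) < \<infinity>))"

text \<open>The measure $\rho(ds|y)\,\eta(dy)$.\<close>
definition intensity ::
  "('y::topological_space \<Rightarrow> 's::topological_space measure) \<Rightarrow> 'y measure \<Rightarrow> ('s \<times> 'y) measure" where
  "intensity \<rho> \<eta> =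
     measure_of UNIV (sets (borel \<Otimes>\<^sub>M borel))
       (\<lambda>A. \<integral>\<^sup>+ y. emeasure (\<rho> y) {s. (s, y) \<in> A} \<partial>\<eta>)"

text \<open>The kernel $e^{-vh(s)}\rho(ds|y)$.\<close>
definition exp_tilt :: "real \<Rightarrow> ('s \<Rightarrow> real) \<Rightarrow> ('y \<Rightarrow> 's measure) \<Rightarrow> 'y \<Rightarrow> 's measure" where
  "exp_tilt v h \<rho> = (\<lambda>y. density (\<rho> y) (\<lambda>s. ennreal (exp (- v * h s))))"

text \<open>The law $\mathcal{P}(dN|\rho,\eta)$.\<close>
definition P_law ::
  "('y::topological_space \<Rightarrow> 's::topological_space measure) \<Rightarrow> 'y measure
     \<Rightarrow> ('s \<times> 'y) measure measure" where
  "P_law \<rho> \<eta> = poisson_law (intensity \<rho> \<eta>)"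

section \<open>The random measure $\mu$, its total mass and its normalization\<close>

text \<open>$\mu(dy) = \int h(s)\,n(ds,dy)$ as a function of the realization \<open>n\<close> of $N$.\<close>
definition mu :: "('s \<Rightarrow> real) \<Rightarrow> ('s \<times> 'y::topological_space) measure \<Rightarrow> 'y measure" where
  "mu h n = distr (density n (\<lambda>(s, y). ennreal (h s))) borel snd"

definition total_mass :: "('s \<Rightarrow> real) \<Rightarrow> ('s \<times> 'y::topological_space) measure \<Rightarrow> ennreal" where
  "total_mass h n = emeasure (mu h n) UNIV"

text \<open>
  $P = \mu/T$.  If $T$ is zero or infinite, the value is the null measure; this event has
  probability zero when $T$ is almost surely finite and $E[T^{-\theta}] < \infty$.
\<close>
definition normalized_mu ::
  "('s \<Rightarrow> real) \<Rightarrow> ('s \<times> 'y::topological_space) measure \<Rightarrow> 'y measure" where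
  "normalized_mu h n = scale_measure (inverse (total_mass h n)) (mu h n)"

text \<open>$E[T^{-\theta}|\rho,\eta]$\<close>
definition T_moment ::
  "('s::topological_space \<Rightarrow> real) \<Rightarrow> ('y::topological_space \<Rightarrow> 's measure) \<Rightarrow> 'y measure
     \<Rightarrow> real \<Rightarrow> ennreal" where
  "T_moment h \<rho> \<eta> \<theta> = (\<integral>\<^sup>+ n. neg_power \<theta> (enn2ereal (total_mass h n)) \<partial>P_law \<rho> \<eta>)"

text \<open>$\tilde{\mathcal{P}}(dP|\rho,\eta,\theta)$\<close>
definition P_tilde ::
  "('s::topological_space \<Rightarrow> real) \<Rightarrow> ('y::topological_space \<Rightarrow> 's measure) \<Rightarrow> 'y measure
     \<Rightarrow> real \<Rightarrow> 'y measure measure" where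
  "P_tilde h \<rho> \<eta> \<theta> =
     distr
       (density (P_law \<rho> \<eta>)
         (\<lambda>n. neg_power \<theta> (enn2ereal (total_mass h n)) / T_moment h \<rho> \<eta> \<theta>))
       (subprob_algebra borel) (normalized_mu h)"

text \<open>The law of $\mu$ when $N$ has law $\mathcal{P}(dN|\rho,\eta)$.\<close>
definition mu_law ::
  "('s::topological_space \<Rightarrow> real) \<Rightarrow> ('y::topological_space \<Rightarrow> 's measure) \<Rightarrow> 'y measure
     \<Rightarrow> 'y measure measure" where
  "mu_law h \<rho> \<eta> = distr (P_law \<rho> \<eta>) (measure_algebra borel) (mu h)"

text \<open>The law $\pi_\theta(dv|\rho,\eta)$, as a measure on the subspace $(0,\infty)$.\<close>
definition pi_law ::
  "('s::topological_space \<Rightarrow> real) \<Rightarrow> ('y::topological_space \<Rightarrow> 's measure) \<Rightarrow> 'y measure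
     \<Rightarrow> real \<Rightarrow> real measure" where
  "pi_law h \<rho> \<eta> \<theta> =
     density (restrict_space lborel {0<..})
       (\<lambda>v. ennreal (v powr (\<theta> - 1))
              * (\<integral>\<^sup>+ n. exp_neg (ereal v * enn2ereal (total_mass h n)) \<partial>P_law \<rho> \<eta>)
            / (ennreal (Gamma \<theta>) * T_moment h \<rho> \<eta> \<theta>))"

text \<open>
  The law of $V\mu_V$, where $V$ has law $\pi_\theta$ and, given $V = v$, $\mu_V$ has the law of
  $\mu$ with $\rho$ replaced by $e^{-vh}\rho$.
\<close>
definition V_mu_V_law ::
  "('s::topological_space \<Rightarrow> real) \<Rightarrow> ('y::topological_space \<Rightarrow> 's measure) \<Rightarrow> 'y measure
     \<Rightarrow> real \<Rightarrow> 'y measure measure" where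
  "V_mu_V_law h \<rho> \<eta> \<theta> =
     pi_law h \<rho> \<eta> \<theta> \<bind>
       (\<lambda>v. distr (mu_law h (exp_tilt v h \<rho>) \<eta>) (measure_algebra borel)
              (scale_measure (ennreal v)))"

end

theory Submission
  imports Defs
begin

text \<open>
  With $x^{-\theta} = \Gamma(\theta)^{-1} \int_0^\infty v^{\theta-1} e^{-vx}\,dv$ and
  $T(1 + Pg) = T + \mu(g)$, the left-hand side becomes a mixture over $v$ of the integrals
  $E[e^{-vT} e^{-v\mu(g)}]$.  The factor $e^{-vT}$ is an exponential tilt, and a Poisson random
  measure tilted in this way is again Poisson, with intensity $e^{-vh}\rho(ds|y)\eta(dy)$.

  Since Poisson laws are defined by their counts, the tilting is read off Laplace functionals:
  counts take values in $\{0, 1, \dots, \infty\}$, so joint laws of counts are determined by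
  their Laplace transforms through the uniqueness of power series coefficients.
\<close>

section \<open>The space of measures\<close>

text \<open>\<open>poisson_law\<close> is a definite description, so evaluating it at the tilted
  intensity requires both uniqueness and existence. Existence needs no construction: the density
  proportional to exp(-vT) with respect to the given Poisson law is itself the witness. Uniqueness
  has to cope with sets of infinite intensity, where counts are infinite; hence the work in
  [0, \<infinity>] with a version of exp(-x) that is multiplicative and continuous up to
  \<infinity>.

  The factor E[exp(-vT)] in the density of \<pi>_\<theta> is exactly the normalizing constant of the
  tilt. The two cancel, and what remains is Tonelli's theorem in v and N.

  The functions f_l may be negative, so 1 + Pg can be nonpositive. The Gamma integral then diverges,
  in agreement with the value \<infinity> of \<open>neg_power\<close>; the identity therefore holds
  in [0, \<infinity>] even where both sides are infinite. The same convention at 0 turns finiteness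
  of the moment into T > 0 almost surely, which is what allows \<mu> to be recovered as T P.\<close>

lemma space_measure_algebra: "space (measure_algebra K) = {m. sets m = sets K}"
  by (auto simp: measure_algebra_def space_Sup_eq_UN)

lemma measure_algebra_cong: "sets K = sets L \<Longrightarrow> measure_algebra K = measure_algebra L"
  by (simp add: measure_algebra_def)

lemma measurable_emeasure_measure_algebra [measurable]:
  "A \<in> sets K \<Longrightarrow> (\<lambda>m. emeasure m A) \<in> borel_measurable (measure_algebra K)"
  by (auto intro!: measurable_Sup1 measurable_vimage_algebra1 simp: measure_algebra_def)

lemma measurable_measure_algebra:
  assumes "\<And>a. a \<in> space M \<Longrightarrow> sets (F a) = sets K"
    and "\<And>A. A \<in> sets K \<Longrightarrow> (\<lambda>a. emeasure (F a) A) \<in> borel_measurable M"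
  shows "F \<in> M \<rightarrow>\<^sub>M measure_algebra K"
  unfolding measure_algebra_def
  using assms by (intro measurable_Sup2) (auto intro!: measurable_vimage_algebra2)

lemma nn_integral_measurable_measure_algebra:
  assumes f: "f \<in> borel_measurable K"
  shows "(\<lambda>m. \<integral>\<^sup>+ x. f x \<partial>m) \<in> borel_measurable (measure_algebra K)"
  using f
proof induct
  case (cong f g)
  moreover have "(\<lambda>m. \<integral>\<^sup>+ x. f x \<partial>m) \<in> borel_measurable (measure_algebra K) \<longleftrightarrow>
      (\<lambda>m. \<integral>\<^sup>+ x. g x \<partial>m) \<in> borel_measurable (measure_algebra K)"
    using cong by (intro measurable_cong nn_integral_cong)
      (auto simp: space_measure_algebra dest!: sets_eq_imp_space_eq)
  ultimately show ?case by simp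
next
  case (set B)
  then have "(\<lambda>m. \<integral>\<^sup>+ x. indicator B x \<partial>m) \<in> borel_measurable (measure_algebra K) \<longleftrightarrow>
      (\<lambda>m. emeasure m B) \<in> borel_measurable (measure_algebra K)"
    by (intro measurable_cong nn_integral_indicator) (simp add: space_measure_algebra)
  with set show ?case by simp
next
  case (mult u c)
  then have "(\<lambda>m. \<integral>\<^sup>+ x. c * u x \<partial>m) \<in> borel_measurable (measure_algebra K) \<longleftrightarrow>
      (\<lambda>m. c * (\<integral>\<^sup>+ x. u x \<partial>m)) \<in> borel_measurable (measure_algebra K)"
    by (intro measurable_cong nn_integral_cmult) (auto simp: space_measure_algebra)
  with mult show ?case by simp
next
  case (add u v)
  then have "(\<lambda>m. \<integral>\<^sup>+ x. v x + u x \<partial>m) \<in> borel_measurable (measure_algebra K) \<longleftrightarrow>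
      (\<lambda>m. (\<integral>\<^sup>+ x. v x \<partial>m) + (\<integral>\<^sup>+ x. u x \<partial>m)) \<in> borel_measurable (measure_algebra K)"
    by (intro measurable_cong nn_integral_add) (auto simp: space_measure_algebra)
  with add show ?case by simp
next
  case (seq F)
  then have "(\<lambda>m. \<integral>\<^sup>+ x. (SUP i. F i) x \<partial>m) \<in> borel_measurable (measure_algebra K) \<longleftrightarrow>
      (\<lambda>m. SUP i. \<integral>\<^sup>+ x. F i x \<partial>m) \<in> borel_measurable (measure_algebra K)"
    unfolding SUP_apply
    by (intro measurable_cong nn_integral_monotone_convergence_SUP) (auto simp: space_measure_algebra)
  with seq show ?case by simp
qed

text \<open>The restriction of \<open>exp_neg\<close> to [0, \<infinity>]. Here no difference of
  infinities can occur, so exp(-(x + y)) = exp(-x) exp(-y) holds without exception, and the function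
  is continuous also at \<infinity>.\<close>

definition nexp :: "ennreal \<Rightarrow> ennreal" where
  "nexp x = (if x = \<infinity> then 0 else ennreal (exp (- enn2real x)))"

lemma exp_neg_enn2ereal: "exp_neg (enn2ereal x) = nexp x"
  using enn2ereal_nonneg[of x] by (auto simp: exp_neg_def nexp_def)

lemma nexp_simps [simp]: "nexp 0 = 1" "nexp \<infinity> = 0" "nexp top = 0"
  by (auto simp: nexp_def)

lemma nexp_ennreal: "0 \<le> r \<Longrightarrow> nexp (ennreal r) = ennreal (exp (- r))"
  by (simp add: nexp_def)

lemma nexp_le_1: "nexp x \<le> 1"
  by (auto simp: nexp_def)

lemma nexp_neq_top [simp]: "nexp x \<noteq> top" "nexp x < top"
  by (auto simp: nexp_def)

lemma nexp_eq_0_iff [simp]: "nexp x = 0 \<longleftrightarrow> x = \<infinity>"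
  by (auto simp: nexp_def)

lemma nexp_add: "nexp (x + y) = nexp x * nexp y"
  by (cases x; cases y)
    (auto simp: nexp_ennreal mult_exp_exp simp flip: ennreal_mult' ennreal_plus)

lemma nexp_sum: "finite I \<Longrightarrow> nexp (\<Sum>i\<in>I. f i) = (\<Prod>i\<in>I. nexp (f i))"
  by (induct I rule: finite_induct) (auto simp: nexp_add)

lemma nexp_antimono: "x \<le> y \<Longrightarrow> nexp y \<le> nexp x"
  by (cases x; cases y) (auto simp: nexp_ennreal top_unique)

lemma borel_measurable_nexp [measurable (raw)]:
  "f \<in> borel_measurable M \<Longrightarrow> (\<lambda>x. nexp (f x)) \<in> borel_measurable M"
proof -
  assume [measurable]: "f \<in> borel_measurable M"
  have "nexp x = (if x < top then ennreal (exp (- enn2real x)) else 0)" for x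
    by (auto simp: nexp_def less_top)
  then show ?thesis by simp
qed

lemma tendsto_nexp:
  assumes f: "(f \<longlongrightarrow> x) F"
  shows "((\<lambda>i. nexp (f i)) \<longlongrightarrow> nexp x) F"
proof (cases "x = \<infinity>")
  case False
  then have "eventually (\<lambda>i. f i < top) F"
    using f by (intro order_tendstoD) (auto simp: top.not_eq_extremum)
  then have "eventually (\<lambda>i. ennreal (exp (- enn2real (f i))) = nexp (f i)) F"
    by eventually_elim (auto simp: nexp_def)
  moreover have "((\<lambda>i. ennreal (exp (- enn2real (f i)))) \<longlongrightarrow> ennreal (exp (- enn2real x))) F"
    using f False by (intro tendsto_intros) (auto simp: less_top)
  ultimately show ?thesis
    using False by (auto simp: nexp_def intro: Lim_transform_eventually)
next
  case True
  show ?thesis unfolding True nexp_simps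
  proof (rule order_tendstoI)
    fix a :: ennreal assume "0 < a"
    \<comment> \<open>Capping at 1 makes - ln r nonnegative, so that \<open>ennreal (- ln r)\<close>
      is a genuine threshold and not truncated to 0.\<close>
    define b where "b = min a 1"
    have b: "0 < b" "b \<le> 1" "b \<le> a" "b < top"
      using \<open>0 < a\<close> by (auto simp: b_def min_less_iff_disj)
    then obtain r where r: "b = ennreal r" "0 < r"
      by (cases b) auto
    have r1: "r \<le> 1" using b r by (simp add: ennreal_le_1)
    have "eventually (\<lambda>i. ennreal (- ln r) < f i) F"
      using f True by (intro order_tendstoD) auto
    then show "eventually (\<lambda>i. nexp (f i) < a) F"
    proof eventually_elim
      case (elim i)
      show ?case
      proof (cases "f i")
        case (real t)
        then have "- ln r < t" using elim by (simp add: ennreal_less_iff r1 r)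
        then have "exp (- t) < exp (ln r)" unfolding exp_less_cancel_iff by simp
        then have "nexp (f i) < b" using real r by (simp add: nexp_ennreal ennreal_less_iff)
        with b show ?thesis by auto
      qed (use \<open>0 < a\<close> in auto)
    qed
  qed auto
qed

section \<open>Laplace transforms of counting variables\<close>

text \<open>The sum of the series tends to its constant term at 0 and vanishes to the right of 0.
  Only positive x are available because x will be exp(-c), hence the one-sided limit.\<close>

lemma power_series_zero_coeff_0:
  fixes a :: "nat \<Rightarrow> real"
  assumes a: "\<And>x. 0 < x \<Longrightarrow> x < 1 \<Longrightarrow> (\<lambda>n. a n * x ^ n) sums 0"
  shows "a 0 = 0"
proof -
  \<comment> \<open>The hypothesis speaks of x in (0, 1) only. Convergence at (|x| + 1)/2, which
    lies strictly between |x| and 1, gives it on the whole disc.\<close>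
  have sm: "summable (\<lambda>n. a n * x ^ n)" if x: "norm x < 1" for x :: real
  proof (rule powser_inside)
    have "0 < (\<bar>x\<bar> + 1) / 2" "(\<bar>x\<bar> + 1) / 2 < 1" using x by auto
    from a[OF this] show "summable (\<lambda>n. a n * ((\<bar>x\<bar> + 1) / 2) ^ n)"
      by (rule sums_summable)
    show "norm x < norm ((\<bar>x\<bar> + 1) / 2)" using x by auto
  qed
  define f where "f x = (\<Sum>n. a n * x ^ n)" for x
  have "(f \<longlongrightarrow> a 0) (at 0)"
    unfolding f_def by (intro powser_limit_0[of 1] summable_sums sm) auto
  then have "(f \<longlongrightarrow> a 0) (at_right 0)"
    by (rule tendsto_mono[rotated]) (simp add: at_le)
  moreover have "eventually (\<lambda>x. f x = 0) (at_right 0)"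
    using eventually_at_right_real[OF zero_less_one]
    by eventually_elim (use a in \<open>auto simp: f_def intro!: sums_unique[symmetric]\<close>)
  then have "(f \<longlongrightarrow> 0) (at_right 0)"
    by (rule tendsto_eventually)
  ultimately show ?thesis
    by (rule tendsto_unique[rotated]) simp
qed

text \<open>Once the constant term is known to vanish, dividing by x shifts the coefficients down by
  one and the induction hypothesis applies to the shifted series.\<close>

lemma power_series_zero_coeff:
  fixes a :: "nat \<Rightarrow> real"
  assumes "\<And>x. 0 < x \<Longrightarrow> x < 1 \<Longrightarrow> (\<lambda>n. a n * x ^ n) sums 0"
  shows "a n = 0"
  using assms
proof (induction n arbitrary: a)
  case 0
  then show ?case by (rule power_series_zero_coeff_0)
next
  case (Suc n)
  have a0: "a 0 = 0"
    using Suc.prems by (rule power_series_zero_coeff_0)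
  show ?case
  proof (rule Suc.IH)
    fix x :: real assume x: "0 < x" "x < 1"
    have "(\<lambda>n. a (Suc n) * x ^ Suc n) sums 0"
      using Suc.prems[OF x] a0 by (subst sums_Suc_iff) simp
    then have "(\<lambda>n. a (Suc n) * x ^ Suc n / x) sums (0 / x)"
      by (rule sums_divide)
    with x show "(\<lambda>n. a (Suc n) * x ^ n) sums 0"
      by simp
  qed
qed

section \<open>Uniqueness of Laplace transforms for variables with values in {0, 1, ...,
  \<infinity>}\<close>

definition extended_nats :: "ennreal set" where
  "extended_nats = insert \<infinity> (range of_nat)"

lemma sets_extended_nats [measurable]: "extended_nats \<in> sets borel"
  unfolding extended_nats_def
  by (rule sets.countable) auto

text \<open>Up to a null set the space splits into the countably many level sets of
  \<open>X\<close>. For this reason \<open>g\<close> may be an arbitrary function, measurable or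
  not.\<close>

lemma nn_integral_extended_nats:
  assumes X [measurable]: "X \<in> borel_measurable M" and "AE w in M. X w \<in> extended_nats"
  shows "(\<integral>\<^sup>+ w. g (X w) \<partial>M) =
    (\<Sum>k. g (of_nat k) * emeasure M {w\<in>space M. X w = of_nat k})
      + g \<infinity> * emeasure M {w\<in>space M. X w = \<infinity>}"
proof -
  define A where "A k = {w\<in>space M. X w = of_nat k}" for k :: nat
  define B where "B = {w\<in>space M. X w = \<infinity>}"
  have A [measurable]: "A k \<in> sets M" for k
    unfolding A_def by measurable
  have "B = X -` {\<infinity>} \<inter> space M" by (auto simp: B_def)
  then have B [measurable]: "B \<in> sets M"
    by (auto intro!: measurable_sets[OF X])
  have disj: "disjoint_family A"
    by (auto simp: disjoint_family_on_def A_def)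
  have "(\<integral>\<^sup>+ w. g (X w) \<partial>M) =
      (\<integral>\<^sup>+ w. (\<Sum>k. g (of_nat k) * indicator (A k) w) + g \<infinity> * indicator B w \<partial>M)"
  proof (rule nn_integral_cong_AE)
    show "AE w in M. g (X w) = (\<Sum>k. g (of_nat k) * indicator (A k) w) + g \<infinity> * indicator B w"
      using assms(2) AE_space
    proof eventually_elim
      case (elim w)
      then have True: "w \<in> space M" by simp
      from elim consider "X w = \<infinity>" | j where "X w = of_nat j"
        by (auto simp: extended_nats_def)
      then show ?case
      proof cases
        case 1
        then have "indicator (A k) w = (0::ennreal)" for k by (auto simp: A_def indicator_def)
        with 1 True show ?thesis by (auto simp: B_def)
      next
        case 2
        then have "w \<in> A j" "w \<notin> B" using True by (auto simp: A_def B_def)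
        with 2 show ?thesis
          using suminf_cmult_indicator[OF disj, of w j "\<lambda>k. g (of_nat k)"] by auto
      qed
    qed
  qed
  also have "\<dots> = (\<Sum>k. g (of_nat k) * emeasure M (A k)) + g \<infinity> * emeasure M B"
    by (subst nn_integral_add) (auto simp: nn_integral_suminf nn_integral_cmult_indicator)
  finally show ?thesis by (simp add: A_def B_def)
qed

text \<open>For c > 0 the value \<infinity> contributes nothing, and the transform is a power series
  in exp(-c) whose coefficients are the masses of the finite values. These agree by uniqueness of
  coefficients; the mass at \<infinity> is what remains of the total mass.\<close>

lemma extended_nats_laplace_eqI:
  assumes "finite_measure M" "finite_measure M'"
    and X [measurable]: "X \<in> borel_measurable M" "AE w in M. X w \<in> extended_nats"
    and Y [measurable]: "Y \<in> borel_measurable M'" "AE w in M'. Y w \<in> extended_nats"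
    and eq: "\<And>c. 0 \<le> c \<Longrightarrow>
      (\<integral>\<^sup>+ w. nexp (ennreal c * X w) \<partial>M) = (\<integral>\<^sup>+ w. nexp (ennreal c * Y w) \<partial>M')"
  shows "(\<integral>\<^sup>+ w. g (X w) \<partial>M) = (\<integral>\<^sup>+ w. g (Y w) \<partial>M')"
proof -
  interpret M: finite_measure M by fact
  interpret M': finite_measure M' by fact
  define p where "p k = measure M {w\<in>space M. X w = of_nat k}" for k :: nat
  define p' where "p' k = measure M' {w\<in>space M'. Y w = of_nat k}" for k :: nat
  have nn: "0 \<le> p k" "0 \<le> p' k" for k by (auto simp: p_def p'_def)
  have bd: "p k \<le> measure M (space M)" "p' k \<le> measure M' (space M')" for k
    by (auto simp: p_def p'_def intro!: M.finite_measure_mono M'.finite_measure_mono)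
  have p: "emeasure M {w\<in>space M. X w = of_nat k} = ennreal (p k)"
    "emeasure M' {w\<in>space M'. Y w = of_nat k} = ennreal (p' k)" for k
    by (auto simp: p_def p'_def M.emeasure_eq_measure M'.emeasure_eq_measure)
  have smb: "summable (\<lambda>k. u k * x ^ k)"
    if "0 < x" "x < 1" "\<And>k. 0 \<le> u k" "\<And>k. u k \<le> m" for x m :: real and u
  proof (rule summable_comparison_test')
    show "summable (\<lambda>k. m * x ^ k)"
      using that by (intro summable_mult summable_geometric) auto
    show "norm (u k * x ^ k) \<le> m * x ^ k" if "0 \<le> k" for k
      using \<open>0 < x\<close> \<open>u k \<le> m\<close> \<open>0 \<le> u k\<close> by (auto simp: abs_mult intro!: mult_right_mono)
  qed
  have "p k - p' k = 0" for k
  proof (rule power_series_zero_coeff[where a = "\<lambda>k. p k - p' k"])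
    fix x :: real assume x: "0 < x" "x < 1"
    \<comment> \<open>The substitution that turns exp(-c k) into x^k.\<close>
    define c where "c = - ln x"
    have c: "0 < c" using x by (simp add: c_def)
    have nx: "nexp (ennreal c * of_nat k) = ennreal (x ^ k)" for k
    proof -
      have "ennreal c * of_nat k = ennreal (c * real k)"
        using c by (simp add: ennreal_mult' ennreal_of_nat_eq_real_of_nat)
      moreover have "exp (- (c * real k)) = x ^ k"
        using x by (simp add: c_def mult.commute exp_of_nat_mult)
      ultimately show ?thesis using c by (simp add: nexp_ennreal)
    qed
    have ninf: "nexp (ennreal c * \<infinity>) = 0"
      using c by (simp add: ennreal_mult_top)
    have s: "summable (\<lambda>k. p k * x ^ k)" "summable (\<lambda>k. p' k * x ^ k)"
      by (rule smb[OF x nn(1) bd(1)], rule smb[OF x nn(2) bd(2)])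
    have "(\<Sum>k. ennreal (p k * x ^ k)) = (\<Sum>k. ennreal (p' k * x ^ k))"
      using eq[of c] c x nn
      unfolding nn_integral_extended_nats[OF X, of "\<lambda>x. nexp (ennreal c * x)"]
        nn_integral_extended_nats[OF Y, of "\<lambda>x. nexp (ennreal c * x)"] p nx ninf
      by (simp add: ennreal_mult'' mult.commute[of "ennreal (x ^ _)"])
    then have "(\<Sum>k. p k * x ^ k) = (\<Sum>k. p' k * x ^ k)"
      using s nn x
      by (simp add: suminf_ennreal2 suminf_nonneg del: suminf_ennreal suminf_ennreal_eq)
    then show "(\<lambda>k. (p k - p' k) * x ^ k) sums 0"
      using sums_diff[OF summable_sums[OF s(1)] summable_sums[OF s(2)]]
      by (simp add: left_diff_distrib)
  qed
  then have pp: "p k = p' k" for k by simp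
  \<comment> \<open>At c = 0 the convention 0 * \<infinity> = 0 makes the integrand 1 everywhere, so
    the transform at 0 is the total mass, the atom at \<infinity> included. The finite part can be
    cancelled because the measures are finite.\<close>
  have "(\<Sum>k. ennreal (p' k)) + emeasure M {w\<in>space M. X w = \<infinity>} =
      (\<Sum>k. ennreal (p' k)) + emeasure M' {w\<in>space M'. Y w = \<infinity>}"
    using eq[of 0] nn_integral_extended_nats[OF X, of "\<lambda>_. 1"]
      nn_integral_extended_nats[OF Y, of "\<lambda>_. 1"]
    by (simp add: p pp)
  moreover have "(\<Sum>k. ennreal (p' k)) \<noteq> top"
  proof -
    have "(\<Sum>k. ennreal (p' k)) \<le> (\<integral>\<^sup>+ w. 1 \<partial>M')"
      unfolding nn_integral_extended_nats[OF Y, of "\<lambda>_. 1"] p by simp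
    then show ?thesis
      using M'.emeasure_finite[of "space M'"] by (auto simp: top_unique)
  qed
  ultimately have "emeasure M {w\<in>space M. X w = \<infinity>} = emeasure M' {w\<in>space M'. Y w = \<infinity>}"
    by (simp add: ennreal_add_left_cancel)
  then show ?thesis
    unfolding nn_integral_extended_nats[OF X, of g] nn_integral_extended_nats[OF Y, of g] p pp
    by simp
qed

lemma finite_measure_density_le_1:
  assumes "finite_measure M" and [measurable]: "u \<in> borel_measurable M" and "\<And>w. u w \<le> 1"
  shows "finite_measure (density M u)"
proof (rule finite_measureI)
  interpret finite_measure M by fact
  have "emeasure (density M u) (space M) = (\<integral>\<^sup>+ w. u w \<partial>M)"
    by (subst emeasure_density) (auto intro!: nn_integral_cong)
  also have "\<dots> \<le> (\<integral>\<^sup>+ w. 1 \<partial>M)"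
    using assms by (intro nn_integral_mono) auto
  finally show "emeasure (density M u) (space (density M u)) \<noteq> \<infinity>"
    by (auto simp: top_unique)
qed

lemma AE_densityI:
  "u \<in> borel_measurable M \<Longrightarrow> AE w in M. P w \<Longrightarrow> AE w in density M u. P w"
  by (subst AE_density) auto

text \<open>The exponentials are replaced by the functions \<open>g i\<close> one variable at a
  time, the other factors being absorbed into the measure as a density. The measures therefore vary
  in the induction, and the bound \<open>g i x \<le> 1\<close> keeps them finite. The measures need
  not have equal mass by assumption: that is the case c = 0.\<close>

lemma joint_extended_nats_laplace_eqI:
  fixes g :: "'i \<Rightarrow> ennreal \<Rightarrow> ennreal"
  assumes "finite I" "finite_measure M" "finite_measure M'"
    and X: "\<And>i. i \<in> I \<Longrightarrow> X i \<in> borel_measurable M"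
      "\<And>i. i \<in> I \<Longrightarrow> AE w in M. X i w \<in> extended_nats"
    and Y: "\<And>i. i \<in> I \<Longrightarrow> Y i \<in> borel_measurable M'"
      "\<And>i. i \<in> I \<Longrightarrow> AE w in M'. Y i w \<in> extended_nats"
    and eq: "\<And>c. (\<And>i. 0 \<le> c i) \<Longrightarrow>
      (\<integral>\<^sup>+ w. nexp (\<Sum>i\<in>I. ennreal (c i) * X i w) \<partial>M) =
      (\<integral>\<^sup>+ w. nexp (\<Sum>i\<in>I. ennreal (c i) * Y i w) \<partial>M')"
    and g: "\<And>i. i \<in> I \<Longrightarrow> g i \<in> borel_measurable borel" "\<And>i x. i \<in> I \<Longrightarrow> g i x \<le> 1"
  shows "(\<integral>\<^sup>+ w. (\<Prod>i\<in>I. g i (X i w)) \<partial>M) = (\<integral>\<^sup>+ w. (\<Prod>i\<in>I. g i (Y i w)) \<partial>M')"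
  using assms
proof (induction I arbitrary: M M' rule: finite_induct)
  case empty
  from empty(7)[of "\<lambda>_. 0"] show ?case by simp
next
  case (insert j I)
  note fin = insert.prems(1,2)
  have [measurable]: "X i \<in> borel_measurable M" "Y i \<in> borel_measurable M'"
    "g i \<in> borel_measurable borel" if "i \<in> insert j I" for i
    using that insert.prems(3,5,8) by auto
  have XN: "AE w in M. X i w \<in> extended_nats" and YN: "AE w in M'. Y i w \<in> extended_nats"
    if "i \<in> insert j I" for i
    using that insert.prems(4,6) by auto
  have g1: "g i x \<le> 1" if "i \<in> insert j I" for i x
    using that insert.prems(9) by auto
  have gX: "(\<lambda>w. g i (X i w)) \<in> borel_measurable M"
    and gY: "(\<lambda>w. g i (Y i w)) \<in> borel_measurable M'" if "i \<in> insert j I" for i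
    using measurable_compose[of "X i" M borel "g i" borel]
      measurable_compose[of "Y i" M' borel "g i" borel] that insert.prems(3,5,8) by auto
  note [measurable] = gX[of j, simplified] gY[of j, simplified]
  have [measurable]: "(\<lambda>w. \<Prod>i\<in>I. g i (X i w)) \<in> borel_measurable M"
    "(\<lambda>w. \<Prod>i\<in>I. g i (Y i w)) \<in> borel_measurable M'"
    by (rule borel_measurable_prod_ennreal, rule gX gY, simp)+
  have SX [measurable]: "(\<lambda>w. nexp (\<Sum>i\<in>I. ennreal (c i) * X i w)) \<in> borel_measurable M"
    and SY [measurable]: "(\<lambda>w. nexp (\<Sum>i\<in>I. ennreal (c i) * Y i w)) \<in> borel_measurable M'" for c
    by (intro borel_measurable_nexp borel_measurable_sum borel_measurable_times
        borel_measurable_const; simp)+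
  have step: "(\<integral>\<^sup>+ w. g j (X j w) * nexp (\<Sum>i\<in>I. ennreal (c i) * X i w) \<partial>M) =
      (\<integral>\<^sup>+ w. g j (Y j w) * nexp (\<Sum>i\<in>I. ennreal (c i) * Y i w) \<partial>M')"
    if c: "\<And>i. 0 \<le> c i" for c
  proof -
    let ?D = "density M (\<lambda>w. nexp (\<Sum>i\<in>I. ennreal (c i) * X i w))"
    let ?D' = "density M' (\<lambda>w. nexp (\<Sum>i\<in>I. ennreal (c i) * Y i w))"
    have "(\<integral>\<^sup>+ w. g j (X j w) \<partial>?D) = (\<integral>\<^sup>+ w. g j (Y j w) \<partial>?D')"
    \<comment> \<open>The coefficients on \<open>I\<close> are frozen in the densities; only the
      coefficient \<open>c0\<close> of \<open>j\<close> varies, which is the univariate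
      situation.\<close>
    proof (rule extended_nats_laplace_eqI[where X = "X j" and Y = "Y j" and g = "g j"])
      fix c0 :: real assume "0 \<le> c0"
      then have c': "0 \<le> (c(j := c0)) i" for i using c by auto
      have *: "(\<Sum>i\<in>insert j I. ennreal ((c(j := c0)) i) * Z i) =
          ennreal c0 * Z j + (\<Sum>i\<in>I. ennreal (c i) * Z i)" for Z
        using insert.hyps by (auto intro!: sum.cong)
      have **: "nexp (\<Sum>i\<in>insert j I. ennreal ((c(j := c0)) i) * Z i) =
          nexp (\<Sum>i\<in>I. ennreal (c i) * Z i) * nexp (ennreal c0 * Z j)" for Z
        unfolding * nexp_add by (rule mult.commute)
      show "(\<integral>\<^sup>+ w. nexp (ennreal c0 * X j w) \<partial>?D) = (\<integral>\<^sup>+ w. nexp (ennreal c0 * Y j w) \<partial>?D')"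
        using insert.prems(7)[of "c(j := c0)", OF c'] unfolding **
        by (simp add: nn_integral_density)
    qed (use fin XN YN in \<open>auto intro!: finite_measure_density_le_1 nexp_le_1 AE_densityI\<close>)
    then show ?thesis
      by (simp add: nn_integral_density mult.commute)
  qed
  let ?E = "density M (\<lambda>w. g j (X j w))"
  let ?E' = "density M' (\<lambda>w. g j (Y j w))"
  have "(\<integral>\<^sup>+ w. (\<Prod>i\<in>I. g i (X i w)) \<partial>?E) = (\<integral>\<^sup>+ w. (\<Prod>i\<in>I. g i (Y i w)) \<partial>?E')"
  \<comment> \<open>Now the factor of \<open>j\<close> is the density, and \<open>step\<close> is
    precisely the equality of the Laplace transforms over \<open>I\<close> under the new
    measures.\<close>
  proof (rule insert.IH)
    fix c :: "'i \<Rightarrow> real" assume "\<And>i. 0 \<le> c i"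
    from step[OF this]
    show "(\<integral>\<^sup>+ w. nexp (\<Sum>i\<in>I. ennreal (c i) * X i w) \<partial>?E) =
        (\<integral>\<^sup>+ w. nexp (\<Sum>i\<in>I. ennreal (c i) * Y i w) \<partial>?E')"
      by (simp add: nn_integral_density)
  qed (use fin XN YN g1 in \<open>auto intro!: finite_measure_density_le_1 AE_densityI\<close>)
  then show ?case
    using insert.hyps by (simp add: nn_integral_density)
qed

section \<open>Laplace functionals of Poisson random measures\<close>

lemma of_nat_extended_nats [simp]: "of_nat k \<in> extended_nats"
  and top_extended_nats [simp]: "top \<in> extended_nats"
  by (auto simp: extended_nats_def)

text \<open>If the supremum is finite, the set lies below some natural number, so it is finite and
  the supremum is a maximum.\<close>

lemma Sup_extended_nats:
  assumes "S \<subseteq> extended_nats" "S \<noteq> {}"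
  shows "Sup S \<in> extended_nats"
proof (cases "Sup S = top")
  case False
  then obtain K where K: "Sup S < of_nat K"
    using ennreal_Ex_less_of_nat by (metis top.not_eq_extremum)
  have "S \<subseteq> of_nat ` {..K}"
  proof
    fix x assume x: "x \<in> S"
    have "x < of_nat K" using Sup_upper[OF x] K by (rule le_less_trans)
    with x assms(1) show "x \<in> of_nat ` {..K}"
      by (auto simp: extended_nats_def)
  qed
  then have "finite S" by (rule finite_subset) auto
  with assms(2) have "Sup S \<in> S"
    using Max_in[of S] by (simp add: Max_Sup)
  with assms(1) show ?thesis by auto
qed (simp only: top_extended_nats)

lemma add_extended_nats: "x \<in> extended_nats \<Longrightarrow> y \<in> extended_nats \<Longrightarrow> x + y \<in> extended_nats"
  using of_nat_extended_nats unfolding extended_nats_def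
  by (auto simp flip: of_nat_add simp del: of_nat_extended_nats)

lemma suminf_extended_nats:
  assumes "\<And>i. f i \<in> extended_nats"
  shows "(\<Sum>i. f i) \<in> extended_nats"
proof -
  have "(\<Sum>i<n. f i) \<in> extended_nats" for n
    by (induct n) (auto intro!: add_extended_nats assms simp: of_nat_extended_nats[of 0, simplified])
  then show ?thesis
    unfolding suminf_eq_SUP by (intro Sup_extended_nats) auto
qed

lemma nexp_less_1: "c \<noteq> 0 \<Longrightarrow> nexp c < 1"
  by (cases c) (auto simp: nexp_ennreal ennreal_less_one_iff)

lemma nexp_mult_of_nat: "nexp (c * of_nat k) = nexp c ^ k"
  by (induct k) (auto simp: distrib_left nexp_add)

text \<open>The Poisson generating function E[a^X] = exp(-l (1 - a)) at a = exp(-c). The case c =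
  \<infinity> is a = 0, where only the term k = 0 survives.\<close>

lemma suminf_poisson:
  assumes "0 \<le> l"
  shows "(\<Sum>k. nexp (c * of_nat k) * ennreal (exp (- l) * l ^ k / fact k)) =
    nexp (ennreal l * (1 - nexp c))"
proof -
  obtain a where a: "nexp c = ennreal a" "0 \<le> a" by (cases "nexp c") auto
  with nexp_le_1[of c] have a1: "a \<le> 1" by simp
  have "(\<lambda>k. (a * l) ^ k /\<^sub>R fact k) sums exp (a * l)"
    by (rule exp_converges)
  then have "(\<lambda>k. exp (- l) * ((a * l) ^ k /\<^sub>R fact k)) sums (exp (- l) * exp (a * l))"
    by (rule sums_mult)
  then have "(\<lambda>k. a ^ k * (exp (- l) * l ^ k / fact k)) sums exp (- (l * (1 - a)))"
    by (simp add: power_mult_distrib divide_inverse mult_ac right_diff_distrib mult_exp_exp)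
  then have "(\<Sum>k. ennreal (a ^ k * (exp (- l) * l ^ k / fact k))) = ennreal (exp (- (l * (1 - a))))"
    using a assms by (subst suminf_ennreal2) (auto simp: sums_iff)
  moreover have "nexp (ennreal l * (1 - nexp c)) = ennreal (exp (- (l * (1 - a))))"
  proof -
    have "ennreal l * (1 - ennreal a) = ennreal (l * (1 - a))"
      using a a1 assms by (simp add: ennreal_mult ennreal_minus flip: ennreal_1)
    then show ?thesis using a assms a1 by (simp add: nexp_ennreal)
  qed
  moreover have "nexp (c * of_nat k) * ennreal (exp (- l) * l ^ k / fact k) =
      ennreal (a ^ k * (exp (- l) * l ^ k / fact k))" for k
    using a assms unfolding nexp_mult_of_nat by (subst ennreal_mult) (auto simp: ennreal_power)
  ultimately show ?thesis by (simp only:)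
qed

text \<open>The prescribed probabilities sum to one, by the generating function at c = 0, so the
  level sets of the natural numbers exhaust the space up to a null set. This is how integrality of
  the counts follows from their probabilities alone.\<close>

lemma poisson_distribution_laplace:
  assumes "prob_space M" and X [measurable]: "X \<in> borel_measurable M" and l: "0 \<le> l"
    and pois: "\<And>k::nat. measure M {w\<in>space M. X w = of_nat k} = exp (- l) * l ^ k / fact k"
  shows "AE w in M. X w \<in> extended_nats"
    and "(\<integral>\<^sup>+ w. nexp (c * X w) \<partial>M) = nexp (ennreal l * (1 - nexp c))"
proof -
  interpret prob_space M by fact
  define A where "A k = {w\<in>space M. X w = of_nat k}" for k :: nat
  have [measurable]: "A k \<in> sets M" for k unfolding A_def by measurable
  have eA: "emeasure M (A k) = ennreal (exp (- l) * l ^ k / fact k)" for k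
    using pois[of k] by (simp add: A_def emeasure_eq_measure)
  have "emeasure M (\<Union>k. A k) = (\<Sum>k. emeasure M (A k))"
    by (intro suminf_emeasure[symmetric]) (auto simp: disjoint_family_on_def A_def)
  also have "\<dots> = 1"
    using suminf_poisson[OF l, of 0] by (simp add: eA)
  finally have "AE w in M. w \<in> (\<Union>k. A k)"
    by (intro AE_in_set_eq_1[THEN iffD2]) (auto simp: measure_def)
  then have AE: "AE w in M. X w \<in> range of_nat"
    by eventually_elim (auto simp: A_def)
  then show ext: "AE w in M. X w \<in> extended_nats"
    by eventually_elim (auto simp: extended_nats_def)
  have "AE w in M. X w \<noteq> \<infinity>"
    using AE by eventually_elim auto
  then have "emeasure M {w\<in>space M. X w = \<infinity>} = 0"
    by (intro emeasure_eq_0_AE) simp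
  then show "(\<integral>\<^sup>+ w. nexp (c * X w) \<partial>M) = nexp (ennreal l * (1 - nexp c))"
    using nn_integral_extended_nats[OF X ext, of "\<lambda>x. nexp (c * x)"] suminf_poisson[OF l, of c]
    by (simp add: eA[unfolded A_def])
qed

text \<open>The Laplace characterization of a Poisson random measure; for sigma-finite
  \<open>L\<close> it is equivalent to \<open>poisson_random_measure\<close>. Integrality of the
  counts is kept as a separate condition because the power series argument relies on it.\<close>

locale poisson_laplace = prob_space M for M :: "'w measure" +
  fixes N :: "'w \<Rightarrow> 'a measure" and L :: "'a measure"
  assumes N [measurable]: "N \<in> M \<rightarrow>\<^sub>M measure_algebra L"
    and AE_extended_nats: "A \<in> sets L \<Longrightarrow> AE w in M. emeasure (N w) A \<in> extended_nats"
    and laplace: "g \<in> borel_measurable L \<Longrightarrow>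
      (\<integral>\<^sup>+ w. nexp (\<integral>\<^sup>+ x. g x \<partial>N w) \<partial>M) = nexp (\<integral>\<^sup>+ x. 1 - nexp (g x) \<partial>L)"

text \<open>The partition into level sets is padded with empty sets to a sequence, the form in which
  independence is available. It does not depend on \<phi>, so that one partition serves for s and
  for 1 - exp(-s).\<close>

lemma simple_function_compose_eq_sum:
  fixes s :: "'a \<Rightarrow> ennreal"
  assumes "simple_function L s"
  obtains A :: "nat \<Rightarrow> 'a set" and c :: "nat \<Rightarrow> ennreal" and n
  where "disjoint_family A" "range A \<subseteq> sets L"
    "\<And>\<phi> x. x \<in> space L \<Longrightarrow> (\<phi> (s x) :: ennreal) = (\<Sum>i<n. \<phi> (c i) * indicator (A i) x)"
proof -
  have fin: "finite (s ` space L)"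
    and sets: "\<And>y. y \<in> s ` space L \<Longrightarrow> s -` {y} \<inter> space L \<in> sets L"
    using assms by (auto simp: simple_function_def)
  define n where "n = card (s ` space L)"
  obtain e where e: "bij_betw e {0..<n} (s ` space L)"
    using ex_bij_betw_nat_finite[OF fin] by (auto simp: n_def)
  define A where "A i = (if i < n then s -` {e i} \<inter> space L else {})" for i
  show thesis
  proof (rule that)
    show "disjoint_family A"
      using bij_betw_imp_inj_on[OF e] by (auto simp: disjoint_family_on_def A_def inj_on_def)
    show "range A \<subseteq> sets L"
      using bij_betwE[OF e] by (auto simp: A_def intro!: sets)
    fix \<phi> :: "ennreal \<Rightarrow> ennreal" and x assume x: "x \<in> space L"
    then obtain j where j: "j < n" "e j = s x"
      using e by (auto simp: bij_betw_def image_iff) (metis atLeastLessThan_iff image_iff)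
    have "indicator (A i) x = (if i = j then 1 else 0 :: ennreal)" if "i < n" for i
      using x j that bij_betw_imp_inj_on[OF e] by (auto simp: A_def inj_on_def indicator_def)
    then have "(\<Sum>i<n. \<phi> (e i) * indicator (A i) x) = (\<Sum>i<n. if i = j then \<phi> (e i) else 0)"
      by (intro sum.cong) auto
    also have "\<dots> = \<phi> (s x)"
      using j by simp
    finally show "\<phi> (s x) = (\<Sum>i<n. \<phi> (e i) * indicator (A i) x)" ..
  qed
qed

text \<open>Independence gives the formula for finite sums over disjoint sets, hence for simple
  functions; an arbitrary \<open>g\<close> is reached by increasing approximation.\<close>

lemma poisson_random_measure_laplace:
  assumes prm: "poisson_random_measure M N L" and "sigma_finite_measure L"
  shows "poisson_laplace M N L"
proof -
  interpret prob_space M using prm by (simp add: poisson_random_measure_def)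
  interpret L: sigma_finite_measure L by fact
  have N [measurable]: "N \<in> M \<rightarrow>\<^sub>M measure_algebra L"
    using prm by (simp add: poisson_random_measure_def)
  have sN: "sets (N w) = sets L" if "w \<in> space M" for w
    using measurable_space[OF N that] by (simp add: space_measure_algebra)
  have pois: "measure M {w\<in>space M. emeasure (N w) A = of_nat k}
      = exp (- measure L A) * measure L A ^ k / fact k"
    if "A \<in> sets L" "emeasure L A < \<infinity>" for A k
    using prm that by (auto simp: poisson_random_measure_def)
  have inf: "AE w in M. emeasure (N w) A = \<infinity>" if "A \<in> sets L" "emeasure L A = \<infinity>" for A
    using prm that by (auto simp: poisson_random_measure_def)
  have indep: "indep_vars (\<lambda>_. borel) (\<lambda>i w. emeasure (N w) (A i)) (UNIV::nat set)"
    if "disjoint_family A" "range A \<subseteq> sets L" for A :: "nat \<Rightarrow> 'b set"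
    using prm that by (auto simp: poisson_random_measure_def)
  have ext_fin: "AE w in M. emeasure (N w) A \<in> extended_nats"
    if "A \<in> sets L" "emeasure L A < \<infinity>" for A
    using that by (intro poisson_distribution_laplace(1)[OF prob_space_axioms _ measure_nonneg pois]) auto
  have one: "(\<integral>\<^sup>+ w. nexp (c * emeasure (N w) A) \<partial>M) = nexp (emeasure L A * (1 - nexp c))"
    if A [measurable]: "A \<in> sets L" for A c
  proof (cases "emeasure L A = \<infinity>")
    case False
    then have "emeasure L A < \<infinity>" by (simp add: less_top)
    from poisson_distribution_laplace(2)[OF _ _ measure_nonneg pois[OF A this], of c] False
    show ?thesis
      by (simp add: emeasure_eq_ennreal_measure prob_space_axioms)
  next
    case True
    have "(\<integral>\<^sup>+ w. nexp (c * emeasure (N w) A) \<partial>M) = (\<integral>\<^sup>+ w. nexp (c * \<infinity>) \<partial>M)"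
      using inf[OF A True] by (intro nn_integral_cong_AE) auto
    also have "\<dots> = nexp (c * \<infinity>)"
      by (simp add: emeasure_space_1)
    also have "\<dots> = nexp (emeasure L A * (1 - nexp c))"
    \<comment> \<open>For c = 0 both sides are 1. Otherwise 1 - exp(-c) is positive, and both
      exponents are infinite.\<close>
    proof (cases "c = 0")
      case False
      then have "0 < 1 - nexp c" by (intro diff_gr0_ennreal nexp_less_1)
      with False True show ?thesis by (simp add: ennreal_mult_top ennreal_top_mult)
    qed simp
    finally show ?thesis .
  qed
  have finite_sum: "(\<integral>\<^sup>+ w. nexp (\<Sum>i<n. c i * emeasure (N w) (A i)) \<partial>M) =
      nexp (\<Sum>i<n. emeasure L (A i) * (1 - nexp (c i)))"
    if A: "disjoint_family A" "range A \<subseteq> sets L" for A :: "nat \<Rightarrow> 'b set" and c n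
  proof -
    have "indep_vars (\<lambda>_. borel) (\<lambda>i w. nexp (c i * emeasure (N w) (A i))) {..<n}"
      using indep_vars_compose2[OF indep_vars_subset[OF indep[OF A]],
        of "{..<n}" "\<lambda>i x. nexp (c i * x)" "\<lambda>_. borel"] by simp
    then have "(\<integral>\<^sup>+ w. (\<Prod>i<n. nexp (c i * emeasure (N w) (A i))) \<partial>M) =
        (\<Prod>i<n. \<integral>\<^sup>+ w. nexp (c i * emeasure (N w) (A i)) \<partial>M)"
      by (intro indep_vars_nn_integral) auto
    then show ?thesis
      using A by (simp add: nexp_sum one image_subset_iff)
  qed
  have simple: "(\<integral>\<^sup>+ w. nexp (\<integral>\<^sup>+ x. s x \<partial>N w) \<partial>M) = nexp (\<integral>\<^sup>+ x. 1 - nexp (s x) \<partial>L)"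
    if s: "simple_function L s" for s
  proof -
    from simple_function_compose_eq_sum[OF s] obtain A c n where
      A: "disjoint_family A" "range A \<subseteq> sets L" and
      eq: "\<And>\<phi> x. x \<in> space L \<Longrightarrow> (\<phi> (s x) :: ennreal) = (\<Sum>i<(n::nat). \<phi> (c i) * indicator (A i) x)"
      by metis
    have "(\<integral>\<^sup>+ x. \<phi> (s x) \<partial>m) = (\<Sum>i<n. \<phi> (c i) * emeasure m (A i))" if m: "sets m = sets L" for m \<phi>
    proof -
      have [measurable]: "A i \<in> sets m" for i using A m by auto
      have "(\<integral>\<^sup>+ x. \<phi> (s x) \<partial>m) = (\<integral>\<^sup>+ x. (\<Sum>i<n. \<phi> (c i) * indicator (A i) x) \<partial>m)"
        using eq[of _ \<phi>] sets_eq_imp_space_eq[OF m] by (intro nn_integral_cong) auto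
      also have "\<dots> = (\<Sum>i<n. \<phi> (c i) * emeasure m (A i))"
        by (subst nn_integral_sum) (auto simp: nn_integral_cmult_indicator)
      finally show ?thesis .
    qed
    note * = this[of _ "\<lambda>x. x"] this[of L "\<lambda>x. 1 - nexp x"]
    have "(\<integral>\<^sup>+ w. nexp (\<integral>\<^sup>+ x. s x \<partial>N w) \<partial>M) =
        (\<integral>\<^sup>+ w. nexp (\<Sum>i<n. c i * emeasure (N w) (A i)) \<partial>M)"
      using sN by (intro nn_integral_cong) (simp add: *)
    then show ?thesis
      unfolding finite_sum[OF A] *(2)[OF refl] by (simp add: mult.commute)
  qed
  have laplace: "(\<integral>\<^sup>+ w. nexp (\<integral>\<^sup>+ x. g x \<partial>N w) \<partial>M) = nexp (\<integral>\<^sup>+ x. 1 - nexp (g x) \<partial>L)"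
    if g: "g \<in> borel_measurable L" for g
  proof -
    \<comment> \<open>On the side of \<open>L\<close> the integrands 1 - exp(-u) increase, so
      monotone convergence applies. On the side of \<open>M\<close> the integrands exp(-N(u))
      decrease, and the bound 1 on a probability space gives dominated convergence.\<close>
    from borel_measurable_implies_simple_function_sequence'[OF g] obtain u where
      u: "\<And>i. simple_function L (u i)" "incseq u" "\<And>x. (SUP i. u i x) = g x" by metis
    have um [measurable]: "u i \<in> borel_measurable L" for i
      using u(1) by (rule borel_measurable_simple_function)
    have lim: "(\<lambda>i. u i x) \<longlonglongrightarrow> g x" for x
      using LIMSEQ_SUP[of "\<lambda>i. u i x"] u(2) by (simp add: u(3) incseq_def le_fun_def)
    have "(\<lambda>i. \<integral>\<^sup>+ x. 1 - nexp (u i x) \<partial>L) \<longlonglongrightarrow> (\<integral>\<^sup>+ x. 1 - nexp (g x) \<partial>L)"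
    proof (rule nn_integral_LIMSEQ)
      show "incseq (\<lambda>i x. 1 - nexp (u i x))"
        using u(2) by (auto simp: incseq_def le_fun_def intro!: ennreal_minus_mono nexp_antimono)
      show "(\<lambda>i. 1 - nexp (u i x)) \<longlonglongrightarrow> 1 - nexp (g x)" for x
        by (intro tendsto_diff_ennreal tendsto_const tendsto_nexp lim) auto
    qed measurable
    then have "(\<lambda>i. nexp (\<integral>\<^sup>+ x. 1 - nexp (u i x) \<partial>L)) \<longlonglongrightarrow> nexp (\<integral>\<^sup>+ x. 1 - nexp (g x) \<partial>L)"
      by (rule tendsto_nexp)
    moreover have "(\<lambda>i. \<integral>\<^sup>+ w. nexp (\<integral>\<^sup>+ x. u i x \<partial>N w) \<partial>M) \<longlonglongrightarrow> (\<integral>\<^sup>+ w. nexp (\<integral>\<^sup>+ x. g x \<partial>N w) \<partial>M)"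
    proof (rule nn_integral_dominated_convergence[where w = "\<lambda>_. 1"])
      have [measurable]: "(\<lambda>w. \<integral>\<^sup>+ x. f x \<partial>N w) \<in> borel_measurable M"
        if "f \<in> borel_measurable L" for f
        using measurable_compose[OF N nn_integral_measurable_measure_algebra[OF that]] .
      show "(\<lambda>w. nexp (\<integral>\<^sup>+ x. u i x \<partial>N w)) \<in> borel_measurable M" for i
        by measurable
      show "(\<lambda>w. nexp (\<integral>\<^sup>+ x. g x \<partial>N w)) \<in> borel_measurable M"
        using g by measurable
      show "AE w in M. (\<lambda>i. nexp (\<integral>\<^sup>+ x. u i x \<partial>N w)) \<longlonglongrightarrow> nexp (\<integral>\<^sup>+ x. g x \<partial>N w)"
      proof (rule AE_I2)
        fix w assume "w \<in> space M"
        then have "u i \<in> borel_measurable (N w)" for i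
          using um by (simp cong: measurable_cong_sets add: sN)
        then show "(\<lambda>i. nexp (\<integral>\<^sup>+ x. u i x \<partial>N w)) \<longlonglongrightarrow> nexp (\<integral>\<^sup>+ x. g x \<partial>N w)"
          using u(2) lim by (intro tendsto_nexp nn_integral_LIMSEQ)
      qed
    qed (auto simp: nexp_le_1 emeasure_space_1)
    ultimately show ?thesis
      unfolding simple[OF u(1)] by (rule LIMSEQ_unique[rotated])
  qed
  have "AE w in M. emeasure (N w) A \<in> extended_nats" if A: "A \<in> sets L" for A
  proof -
    \<comment> \<open>The set is cut into pieces of finite intensity, where the counts are already
      known to be integers; a series of extended naturals is again one.\<close>
    from L.sigma_finite_disjoint obtain B where B: "range B \<subseteq> sets L" "(\<Union>i. B i) = space L"
      "\<And>i. emeasure L (B i) \<noteq> \<infinity>" "disjoint_family (B :: nat \<Rightarrow> _)" by metis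
    have "AE w in M. emeasure (N w) (A \<inter> B i) \<in> extended_nats" for i
    proof (rule ext_fin)
      show "A \<inter> B i \<in> sets L" using A B by auto
      have "emeasure L (A \<inter> B i) \<le> emeasure L (B i)" using B by (intro emeasure_mono) auto
      with B(3)[of i] show "emeasure L (A \<inter> B i) < \<infinity>"
        by (metis infinity_ennreal_def le_less_trans top.not_eq_extremum)
    qed
    then have "AE w in M. \<forall>i. emeasure (N w) (A \<inter> B i) \<in> extended_nats"
      by (simp add: AE_all_countable)
    with AE_space show ?thesis
    proof eventually_elim
      case (elim w)
      have "A = (\<Union>i. A \<inter> B i)" using A B(2) sets.sets_into_space by blast
      moreover have "(\<Sum>i. emeasure (N w) (A \<inter> B i)) = emeasure (N w) (\<Union>i. A \<inter> B i)"
        using A B elim sN[of w]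
        by (intro suminf_emeasure) (auto simp: disjoint_family_on_def, blast)
      ultimately show ?case
        using suminf_extended_nats[of "\<lambda>i. emeasure (N w) (A \<inter> B i)"] elim by simp
    qed
  qed
  with N laplace show ?thesis
    by unfold_locales
qed

text \<open>At each point at most one summand is nonzero, and 1 - exp(-t) vanishes at t = 0, so it
  may be applied term by term.\<close>

lemma one_minus_nexp_sum_disjoint:
  assumes J: "finite J" and disj: "disjoint_family_on A J"
  shows "1 - nexp (\<Sum>i\<in>J. c i * indicator (A i) x) = (\<Sum>i\<in>J. (1 - nexp (c i)) * indicator (A i) x)"
proof (cases "\<exists>j\<in>J. x \<in> A j")
  case True
  then obtain j where j: "j \<in> J" "x \<in> A j" by auto
  have "indicator (A i) x = (if i = j then 1 else 0 :: ennreal)" if "i \<in> J" for i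
    using disj j that by (auto simp: disjoint_family_on_def indicator_def)
  then have "(\<Sum>i\<in>J. \<phi> i * indicator (A i) x) = \<phi> j" for \<phi> :: "_ \<Rightarrow> ennreal"
    using J j by (subst sum.cong[OF refl, of J _ "\<lambda>i. if i = j then \<phi> i else 0"]) auto
  then show ?thesis by simp
qed (use J in simp)

lemma prod_indicator_INT:
  "finite J \<Longrightarrow> (\<Prod>j\<in>J. indicator (E j) x) = (indicator (\<Inter>j\<in>J. E j) x :: ennreal)"
  by (induct J rule: finite_induct) (auto simp: indicator_def)

section \<open>From the Laplace functional back to counts and independence\<close>

context poisson_laplace
begin

lemma sets_N: "w \<in> space M \<Longrightarrow> sets (N w) = sets L"
  using measurable_space[OF N] by (simp add: space_measure_algebra)

lemma measurable_N [measurable]: "A \<in> sets L \<Longrightarrow> (\<lambda>w. emeasure (N w) A) \<in> borel_measurable M"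
  by (rule measurable_compose[OF N measurable_emeasure_measure_algebra])

text \<open>The sets may overlap. This generality is what uniqueness requires, where arbitrary
  finite families of sets are tested.\<close>

lemma laplace_sum:
  assumes J: "finite J" and A: "\<And>i. i \<in> J \<Longrightarrow> A i \<in> sets L"
  shows "(\<integral>\<^sup>+ w. nexp (\<Sum>i\<in>J. c i * emeasure (N w) (A i)) \<partial>M) =
    nexp (\<integral>\<^sup>+ x. 1 - nexp (\<Sum>i\<in>J. c i * indicator (A i) x) \<partial>L)"
proof -
  have "(\<integral>\<^sup>+ w. nexp (\<Sum>i\<in>J. c i * emeasure (N w) (A i)) \<partial>M) =
      (\<integral>\<^sup>+ w. nexp (\<integral>\<^sup>+ x. (\<Sum>i\<in>J. c i * indicator (A i) x) \<partial>N w) \<partial>M)"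
  proof (rule nn_integral_cong)
    fix w assume "w \<in> space M"
    then have "A i \<in> sets (N w)" if "i \<in> J" for i using A that sets_N by auto
    then show "nexp (\<Sum>i\<in>J. c i * emeasure (N w) (A i)) =
        nexp (\<integral>\<^sup>+ x. (\<Sum>i\<in>J. c i * indicator (A i) x) \<partial>N w)"
      by (subst nn_integral_sum) (auto simp: nn_integral_cmult_indicator)
  qed
  also have "\<dots> = nexp (\<integral>\<^sup>+ x. 1 - nexp (\<Sum>i\<in>J. c i * indicator (A i) x) \<partial>L)"
    using A by (intro laplace borel_measurable_sum borel_measurable_times) auto
  finally show ?thesis .
qed

lemma laplace_disjoint:
  assumes J: "finite J" "disjoint_family_on A J" and A: "\<And>i. i \<in> J \<Longrightarrow> A i \<in> sets L"
  shows "(\<integral>\<^sup>+ w. nexp (\<Sum>i\<in>J. c i * emeasure (N w) (A i)) \<partial>M) =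
    (\<Prod>i\<in>J. nexp (emeasure L (A i) * (1 - nexp (c i))))"
proof -
  have "(\<integral>\<^sup>+ x. 1 - nexp (\<Sum>i\<in>J. c i * indicator (A i) x) \<partial>L) =
      (\<Sum>i\<in>J. emeasure L (A i) * (1 - nexp (c i)))"
    unfolding one_minus_nexp_sum_disjoint[OF J]
    using A by (subst nn_integral_sum) (auto simp: nn_integral_cmult_indicator mult.commute[of "emeasure L _"])
  then show ?thesis
    using laplace_sum[OF J(1) A, where c = c] J(1) by (simp add: nexp_sum)
qed

lemma laplace_single:
  assumes "A \<in> sets L"
  shows "(\<integral>\<^sup>+ w. nexp (c * emeasure (N w) A) \<partial>M) = nexp (emeasure L A * (1 - nexp c))"
  using laplace_disjoint[of "{()}" "\<lambda>_. A" "\<lambda>_. c"] assms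
  by (simp add: disjoint_family_on_def)

text \<open>The count is compared with the identity under an explicit Poisson law \<open>M'\<close>
  on the natural numbers: equal Laplace transforms, hence equal point masses.\<close>

lemma prob_eq_poisson:
  assumes A: "A \<in> sets L" "emeasure L A < \<infinity>"
  shows "prob {w\<in>space M. emeasure (N w) A = of_nat k} = exp (- measure L A) * measure L A ^ k / fact k"
proof -
  define l where "l = measure L A"
  define p where "p k = exp (- l) * l ^ k / fact k" for k
  define M' where "M' = density (count_space UNIV) (\<lambda>k. ennreal (p k))"
  have l: "0 \<le> l" "emeasure L A = ennreal l"
    using A(2) by (auto simp: l_def emeasure_eq_ennreal_measure)
  have int: "(\<integral>\<^sup>+ k. u k \<partial>M') = (\<Sum>k. u k * ennreal (p k))" for u
    unfolding M'_def by (simp add: nn_integral_density nn_integral_count_space_nat mult.commute)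
  have "(\<integral>\<^sup>+ w. indicator {of_nat k} (emeasure (N w) A) \<partial>M) =
      (\<integral>\<^sup>+ j. indicator {of_nat k} (of_nat j :: ennreal) \<partial>M')"
  proof (rule extended_nats_laplace_eqI[where X = "\<lambda>w. emeasure (N w) A" and Y = of_nat])
    have "emeasure M' (space M') = (\<integral>\<^sup>+ k. 1 \<partial>M')" by simp
    also have "\<dots> = 1"
      unfolding int using suminf_poisson[OF l(1), of 0] by (simp add: p_def)
    finally show "finite_measure M'" by (intro finite_measureI) simp
    show "(\<integral>\<^sup>+ w. nexp (ennreal c * emeasure (N w) A) \<partial>M) =
        (\<integral>\<^sup>+ j. nexp (ennreal c * of_nat j) \<partial>M')" for c
      unfolding int laplace_single[OF A(1)] l p_def suminf_poisson[OF l(1)] ..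
  qed (use A AE_extended_nats in \<open>auto simp: M'_def finite_measure_axioms\<close>)
  also have "\<dots> = (\<Sum>j. if j = k then ennreal (p j) else 0)"
    unfolding int by (intro suminf_cong) (auto simp: indicator_def)
  also have "\<dots> = ennreal (p k)"
    using sums_single[of k "\<lambda>j. ennreal (p j)"] by (simp add: sums_iff)
  also have "(\<integral>\<^sup>+ w. indicator {of_nat k} (emeasure (N w) A) \<partial>M) =
      (\<integral>\<^sup>+ w. indicator {w\<in>space M. emeasure (N w) A = of_nat k} w \<partial>M)"
    by (intro nn_integral_cong) (auto simp: indicator_def)
  finally have "emeasure M {w\<in>space M. emeasure (N w) A = of_nat k} = ennreal (p k)"
    using A(1) by (subst (asm) nn_integral_indicator) auto
  then show ?thesis
    using l(1) by (simp add: emeasure_eq_measure p_def l_def)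
qed

text \<open>With c = 1 the Laplace formula says that the nonnegative variable exp(-N(A)) has
  integral 0, so it vanishes almost surely.\<close>

lemma AE_infinite:
  assumes A: "A \<in> sets L" "emeasure L A = \<infinity>"
  shows "AE w in M. emeasure (N w) A = \<infinity>"
proof -
  have "0 < 1 - nexp 1" by (intro diff_gr0_ennreal nexp_less_1) auto
  then have "(\<integral>\<^sup>+ w. nexp (emeasure (N w) A) \<partial>M) = 0"
    using laplace_single[OF A(1), of 1] A(2) by (simp add: ennreal_top_mult)
  then show ?thesis
    using A(1) by (subst (asm) nn_integral_0_iff_AE) auto
qed

text \<open>The joint law of the counts is compared with the product of their marginal laws. Both
  have Laplace transforms that factorize, the former by disjointness of the sets, so they integrate
  products of bounded functions equally; indicators give independence.\<close>

lemma indep_vars_disjoint: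
  fixes A :: "'i \<Rightarrow> 'a set"
  assumes A: "disjoint_family A" "range A \<subseteq> sets L"
  shows "indep_vars (\<lambda>_. borel) (\<lambda>i w. emeasure (N w) (A i)) UNIV"
proof -
  define X where "X i w = emeasure (N w) (A i)" for i w
  have [measurable]: "A i \<in> sets L" for i using A by auto
  have X [measurable]: "X i \<in> borel_measurable M" for i
    unfolding X_def by measurable
  have ext: "AE w in M. X i w \<in> extended_nats" for i
    unfolding X_def by (intro AE_extended_nats) simp
  define D where "D i = distr M borel (X i)" for i
  have D: "prob_space (D i)" for i
    unfolding D_def by (rule prob_space_distr) simp
  interpret P: product_prob_space D UNIV
    by (simp add: product_prob_space_def product_prob_space_axioms_def product_sigma_finite_def D
        prob_space_imp_sigma_finite)
  have extD: "AE x in D i. x \<in> extended_nats" for i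
    unfolding D_def using ext by (subst AE_distr_iff) auto
  have sD [measurable_cong]: "sets (D i) = sets borel" for i
    by (simp add: D_def)
  have intD: "(\<integral>\<^sup>+ x. g x \<partial>D i) = (\<integral>\<^sup>+ w. g (X i w) \<partial>M)" if "g \<in> borel_measurable borel" for g i
    unfolding D_def using that by (subst nn_integral_distr) auto
  have prod: "(\<integral>\<^sup>+ w. (\<Prod>i\<in>J. g i (X i w)) \<partial>M) = (\<Prod>i\<in>J. \<integral>\<^sup>+ w. g i (X i w) \<partial>M)"
    if J: "finite J" and g: "\<And>i. g i \<in> borel_measurable borel" "\<And>i x. g i x \<le> 1" for J g
  proof -
    have fac: "(\<integral>\<^sup>+ x. (\<Prod>i\<in>J. u i (x i)) \<partial>PiM J D) = (\<Prod>i\<in>J. \<integral>\<^sup>+ w. u i (X i w) \<partial>M)"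
      if "\<And>i. u i \<in> borel_measurable borel" for u
      using J that by (subst P.product_nn_integral_prod) (auto simp: intD)
    have disj: "disjoint_family_on A J" using A(1) by (auto simp: disjoint_family_on_def)
    have "(\<integral>\<^sup>+ w. (\<Prod>i\<in>J. g i (X i w)) \<partial>M) = (\<integral>\<^sup>+ x. (\<Prod>i\<in>J. g i (x i)) \<partial>PiM J D)"
    proof (rule joint_extended_nats_laplace_eqI[where X = X and Y = "\<lambda>i x. x i"])
      show "finite_measure (PiM J D)"
        by (intro prob_space.finite_measure prob_space_PiM D)
      show "AE x in PiM J D. x i \<in> extended_nats" if "i \<in> J" for i
        by (rule AE_PiM_component) (use that D extD in auto)
      fix c :: "'i \<Rightarrow> real"
      have "(\<integral>\<^sup>+ x. nexp (\<Sum>i\<in>J. ennreal (c i) * x i) \<partial>PiM J D) =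
          (\<Prod>i\<in>J. \<integral>\<^sup>+ w. nexp (ennreal (c i) * X i w) \<partial>M)"
        using fac[of "\<lambda>i x. nexp (ennreal (c i) * x)"] by (simp add: nexp_sum J)
      also have "\<dots> = (\<integral>\<^sup>+ w. nexp (\<Sum>i\<in>J. ennreal (c i) * X i w) \<partial>M)"
        using laplace_disjoint[OF J disj, of "\<lambda>i. ennreal (c i)"] laplace_single by (simp add: X_def)
      finally show "(\<integral>\<^sup>+ w. nexp (\<Sum>i\<in>J. ennreal (c i) * X i w) \<partial>M) =
          (\<integral>\<^sup>+ x. nexp (\<Sum>i\<in>J. ennreal (c i) * x i) \<partial>PiM J D)" ..
    qed (use J g ext in \<open>auto simp: finite_measure_axioms\<close>)
    also have "\<dots> = (\<Prod>i\<in>J. \<integral>\<^sup>+ w. g i (X i w) \<partial>M)"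
      by (rule fac) (rule g)
    finally show ?thesis .
  qed
  have "indep_vars (\<lambda>_. borel) X UNIV"
    unfolding indep_vars_def2
  proof (intro conjI ballI indep_setsI)
    fix E J assume J: "J \<noteq> {}" "finite J" "J \<subseteq> UNIV"
      and E: "\<forall>j\<in>J. E j \<in> {X j -` B \<inter> space M |B. B \<in> sets borel}"
    then have "\<forall>j\<in>J. \<exists>B. B \<in> sets borel \<and> E j = X j -` B \<inter> space M" by auto
    then obtain B where B: "\<And>j. j \<in> J \<Longrightarrow> B j \<in> sets borel \<and> E j = X j -` B j \<inter> space M"
      by metis
    \<comment> \<open>\<open>prod\<close> asks for measurability at every index, also outside
      \<open>J\<close>, where \<open>B\<close> is unspecified.\<close>
    define B' where "B' j = (if j \<in> J then B j else {})" for j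
    have [measurable]: "B' j \<in> sets borel" for j using B by (auto simp: B'_def)
    have E_sets: "E j \<in> events" if "j \<in> J" for j using B[OF that] by auto
    have ind: "indicator (B' j) (X j w) = (indicator (E j) w :: ennreal)" if "j \<in> J" "w \<in> space M" for j w
      using B[OF that(1)] that by (auto simp: B'_def indicator_def)
    have "ennreal (prob (\<Inter>j\<in>J. E j)) = (\<integral>\<^sup>+ w. indicator (\<Inter>j\<in>J. E j) w \<partial>M)"
      using J E_sets by (subst nn_integral_indicator) (auto simp: emeasure_eq_measure)
    also have "\<dots> = (\<integral>\<^sup>+ w. (\<Prod>j\<in>J. indicator (B' j) (X j w)) \<partial>M)"
      using J ind by (intro nn_integral_cong) (simp add: prod_indicator_INT)
    also have "\<dots> = (\<Prod>j\<in>J. \<integral>\<^sup>+ w. indicator (B' j) (X j w) \<partial>M)"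
      using J by (intro prod) (auto simp: indicator_def)
    also have "\<dots> = (\<Prod>j\<in>J. ennreal (prob (E j)))"
    proof (intro prod.cong refl)
      fix j assume j: "j \<in> J"
      have "(\<integral>\<^sup>+ w. indicator (B' j) (X j w) \<partial>M) = (\<integral>\<^sup>+ w. indicator (E j) w \<partial>M)"
        using ind[OF j] by (intro nn_integral_cong) simp
      then show "(\<integral>\<^sup>+ w. indicator (B' j) (X j w) \<partial>M) = ennreal (prob (E j))"
        using E_sets[OF j] by (simp add: emeasure_eq_measure)
    qed
    finally show "prob (\<Inter>j\<in>J. E j) = (\<Prod>j\<in>J. prob (E j))"
      by (simp add: prod_ennreal prod_nonneg)
  qed auto
  then show ?thesis unfolding X_def .
qed

lemma poisson_random_measure: "poisson_random_measure M N L"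
  unfolding poisson_random_measure_def
  using prob_space_axioms prob_eq_poisson AE_infinite indep_vars_disjoint by auto

end

section \<open>Uniqueness of Poisson laws and the evaluation of \<open>poisson_law\<close>\<close>

text \<open>A measure is encoded by \<Phi> as the family of its values on all measurable sets, a
  point of a possibly uncountable product. The Laplace functional fixes the joint laws of finitely
  many coordinates, hence the image law under \<Phi>, and every event of
  \<open>measure_algebra\<close> is a preimage under \<Phi>.\<close>

lemma poisson_laplace_unique:
  assumes Q: "poisson_laplace Q (\<lambda>m. m) L" "sets Q = sets (measure_algebra L)"
    and Q': "poisson_laplace Q' (\<lambda>m. m) L" "sets Q' = sets (measure_algebra L)"
  shows "Q = Q'"
proof -
  interpret Q: poisson_laplace Q "\<lambda>m. m" L by fact
  interpret Q': poisson_laplace Q' "\<lambda>m. m" L by fact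
  note [measurable_cong] = Q(2) Q'(2)
  have sp: "space Q = space (measure_algebra L)" "space Q' = space (measure_algebra L)"
    using Q(2) Q'(2) by (auto dest: sets_eq_imp_space_eq)
  let ?P = "PiM (sets L) (\<lambda>_. borel :: ennreal measure)"
  define \<Phi> where "\<Phi> m = (\<lambda>A\<in>sets L. emeasure m A)" for m :: "'a measure"
  have \<Phi> [measurable]: "\<Phi> \<in> measure_algebra L \<rightarrow>\<^sub>M ?P"
    unfolding \<Phi>_def by (intro measurable_restrict) measurable
  have distr_eq: "distr Q ?P \<Phi> = distr Q' ?P \<Phi>"
  proof (rule measure_eqI_PiM_infinite)
    show "finite_measure (distr Q ?P \<Phi>)"
      by (intro prob_space.finite_measure Q.prob_space_distr) measurable
    fix B :: "'a set \<Rightarrow> ennreal set" and J :: "'a set set"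
    assume J: "finite J" "J \<subseteq> sets L" and B: "\<And>A. A \<in> J \<Longrightarrow> B A \<in> sets borel"
    let ?E = "prod_emb (sets L) (\<lambda>_. borel) J (Pi\<^sub>E J B)"
    have E [measurable]: "?E \<in> sets ?P"
      using J B by (intro sets_PiM_I) auto
    have ind: "indicator ?E (\<Phi> m) = (\<Prod>A\<in>J. indicator (B A) (emeasure m A) :: ennreal)" for m
    proof -
      have "\<Phi> m \<in> ?E \<longleftrightarrow> (\<forall>A\<in>J. emeasure m A \<in> B A)"
        using J(2) by (auto simp: prod_emb_def \<Phi>_def PiE_iff space_PiM restrict_def subset_eq extensional_def)
      then show ?thesis
        using J by (auto simp: indicator_def intro!: prod.neutral[symmetric] prod_zero[symmetric])
    qed
    have "(\<integral>\<^sup>+ m. (\<Prod>A\<in>J. indicator (B A) (emeasure m A)) \<partial>Q) =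
        (\<integral>\<^sup>+ m. (\<Prod>A\<in>J. indicator (B A) (emeasure m A)) \<partial>Q')"
    proof (rule joint_extended_nats_laplace_eqI
        [where X = "\<lambda>A m. emeasure m A" and Y = "\<lambda>A m. emeasure m A"])
      show "finite J" by fact
      show "(\<integral>\<^sup>+ m. nexp (\<Sum>A\<in>J. ennreal (c A) * emeasure m A) \<partial>Q) =
          (\<integral>\<^sup>+ m. nexp (\<Sum>A\<in>J. ennreal (c A) * emeasure m A) \<partial>Q')" for c
        using Q.laplace_sum[OF J(1), of "\<lambda>A. A"] Q'.laplace_sum[OF J(1), of "\<lambda>A. A"] J(2)
        by (simp add: subset_eq)
      fix A assume A: "A \<in> J"
      with J(2) have AL: "A \<in> sets L" by auto
      show "(\<lambda>m. emeasure m A) \<in> borel_measurable Q" "(\<lambda>m. emeasure m A) \<in> borel_measurable Q'"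
        using AL by (rule Q.measurable_N Q'.measurable_N)+
      show "AE m in Q. emeasure m A \<in> extended_nats" "AE m in Q'. emeasure m A \<in> extended_nats"
        using AL by (rule Q.AE_extended_nats Q'.AE_extended_nats)+
      show "(indicator (B A) :: ennreal \<Rightarrow> ennreal) \<in> borel_measurable borel"
        using B[OF A] by measurable
    qed (auto simp: indicator_def intro: Q.finite_measure_axioms Q'.finite_measure_axioms)
    then have "(\<integral>\<^sup>+ m. indicator ?E (\<Phi> m) \<partial>Q) = (\<integral>\<^sup>+ m. indicator ?E (\<Phi> m) \<partial>Q')"
      unfolding ind .
    then have "(\<integral>\<^sup>+ m. indicator ?E m \<partial>distr Q ?P \<Phi>) = (\<integral>\<^sup>+ m. indicator ?E m \<partial>distr Q' ?P \<Phi>)"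
      by (subst (1 2) nn_integral_distr) measurable
    then show "emeasure (distr Q ?P \<Phi>) ?E = emeasure (distr Q' ?P \<Phi>) ?E"
      by simp
  qed simp_all
  show ?thesis
  proof (rule measure_eqI)
    show "sets Q = sets Q'" using Q(2) Q'(2) by simp
    fix S assume "S \<in> sets Q"
    then have S: "S \<in> sets (measure_algebra L)" by (simp add: Q(2))
    \<comment> \<open>Every evaluation factors through \<Phi>, so the sigma-algebra generated by
      \<Phi> contains the one generated by the evaluations.\<close>
    have "(\<lambda>m. m) \<in> vimage_algebra (space (measure_algebra L)) \<Phi> ?P \<rightarrow>\<^sub>M measure_algebra L"
    proof (rule measurable_measure_algebra)
      fix A assume A: "A \<in> sets L"
      have "\<Phi> \<in> vimage_algebra (space (measure_algebra L)) \<Phi> ?P \<rightarrow>\<^sub>M ?P"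
        by (rule measurable_vimage_algebra1, rule Pi_I) (rule measurable_space[OF \<Phi>])
      from measurable_compose[OF this measurable_component_singleton[OF A]]
      have "(\<lambda>m. \<Phi> m A) \<in> borel_measurable (vimage_algebra (space (measure_algebra L)) \<Phi> ?P)" .
      moreover have "(\<lambda>m. \<Phi> m A) = (\<lambda>m. emeasure m A)"
        using A by (simp add: \<Phi>_def)
      ultimately show "(\<lambda>m. emeasure m A) \<in> borel_measurable (vimage_algebra (space (measure_algebra L)) \<Phi> ?P)"
        by (simp only:)
    qed (simp add: space_measure_algebra)
    from measurable_sets[OF this S]
    have "S \<inter> space (measure_algebra L) \<in> sets (vimage_algebra (space (measure_algebra L)) \<Phi> ?P)"
      by (simp only: vimage_ident space_vimage_algebra)
    then have "S \<in> sets (vimage_algebra (space (measure_algebra L)) \<Phi> ?P)"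
      unfolding Int_absorb2[OF sets.sets_into_space[OF S]] .
    moreover have \<Phi>_space: "\<Phi> \<in> space (measure_algebra L) \<rightarrow> space ?P"
      by (rule Pi_I) (rule measurable_space[OF \<Phi>])
    ultimately have "S \<in> {\<Phi> -` A \<inter> space (measure_algebra L) | A. A \<in> sets ?P}"
      by (simp only: sets_vimage_algebra2[OF \<Phi>_space])
    then obtain S' where S': "S' \<in> sets ?P" "S = \<Phi> -` S' \<inter> space (measure_algebra L)"
      by blast
    have "emeasure (distr Q ?P \<Phi>) S' = emeasure (distr Q' ?P \<Phi>) S'"
      by (simp add: distr_eq)
    then show "emeasure Q S = emeasure Q' S"
      using S' by (simp add: emeasure_distr sp)
  qed
qed

text \<open>\<open>Q\<close> is the witness for the definite description. Sigma-finiteness serves to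
  bring every competing law into Laplace form, where uniqueness applies.\<close>

lemma poisson_law_eqI:
  assumes Q: "poisson_laplace Q (\<lambda>m. m) L" "sets Q = sets (measure_algebra L)"
    and L: "sigma_finite_measure L"
  shows "poisson_law L = Q"
  unfolding poisson_law_def
proof (rule the_equality)
  show "sets Q = sets (measure_algebra L) \<and> poisson_random_measure Q (\<lambda>m. m) L"
    using poisson_laplace.poisson_random_measure[OF Q(1)] Q(2) by simp
  show "Q' = Q" if "sets Q' = sets (measure_algebra L) \<and> poisson_random_measure Q' (\<lambda>m. m) L" for Q'
    using that poisson_random_measure_laplace[OF _ L] poisson_laplace_unique[OF _ _ Q] by blast
qed

lemma (in poisson_laplace) poisson_laplace_distr:
  "poisson_laplace (distr M (measure_algebra L) N) (\<lambda>m. m) L"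
proof -
  interpret D: prob_space "distr M (measure_algebra L) N"
    by (rule prob_space_distr) measurable
  show ?thesis
  proof
    show "AE m in distr M (measure_algebra L) N. emeasure m A \<in> extended_nats" if "A \<in> sets L" for A
      using AE_extended_nats[OF that] that by (subst AE_distr_iff) auto
    show "(\<integral>\<^sup>+ m. nexp (\<integral>\<^sup>+ x. g x \<partial>m) \<partial>distr M (measure_algebra L) N) =
        nexp (\<integral>\<^sup>+ x. 1 - nexp (g x) \<partial>L)" if "g \<in> borel_measurable L" for g
      using laplace[OF that] nn_integral_measurable_measure_algebra[OF that]
      by (subst nn_integral_distr) auto
  qed simp
qed

lemma poisson_law_eq_distr:
  assumes "poisson_random_measure M N L" and L: "sigma_finite_measure L"
  shows "poisson_law L = distr M (measure_algebra L) N"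
  using poisson_laplace.poisson_laplace_distr[OF poisson_random_measure_laplace[OF assms]] L
  by (intro poisson_law_eqI) auto

text \<open>Exponential tilting of a Poisson random measure tilts its intensity, because
  $1 - e^{-(g+H)} = (1 - e^{-H}) + e^{-H}(1 - e^{-g})$.\<close>
lemma poisson_laplace_density:
  assumes Q: "poisson_laplace Q (\<lambda>m. m) L" "sets Q = sets (measure_algebra L)"
    and H [measurable]: "H \<in> borel_measurable L"
    and Z: "Z = (\<integral>\<^sup>+ m. nexp (\<integral>\<^sup>+ x. H x \<partial>m) \<partial>Q)" "Z \<noteq> 0"
  shows "poisson_laplace (density Q (\<lambda>m. nexp (\<integral>\<^sup>+ x. H x \<partial>m) / Z)) (\<lambda>m. m)
    (density L (\<lambda>x. nexp (H x)))" (is "poisson_laplace ?D _ ?L")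
proof -
  interpret Q: poisson_laplace Q "\<lambda>m. m" L by fact
  note [measurable_cong] = Q(2)
  have Z_top: "Z \<noteq> top"
  proof -
    have "Z \<le> (\<integral>\<^sup>+ m. 1 \<partial>Q)" unfolding Z(1) by (intro nn_integral_mono nexp_le_1)
    then show ?thesis by (auto simp: Q.emeasure_space_1 top_unique)
  qed
  have int [measurable]: "(\<lambda>m. \<integral>\<^sup>+ x. g x \<partial>m) \<in> borel_measurable Q" if "g \<in> borel_measurable L" for g
    using nn_integral_measurable_measure_algebra[OF that] by simp
  have D: "(\<integral>\<^sup>+ m. u m \<partial>?D) = (\<integral>\<^sup>+ m. nexp (\<integral>\<^sup>+ x. H x \<partial>m) * u m \<partial>Q) / Z"
    if [measurable]: "u \<in> borel_measurable Q" for u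
    by (simp add: nn_integral_density ennreal_divide_times divide_ennreal_def mult.assoc mult.commute[of "inverse Z"]
        nn_integral_multc flip: mult.assoc)
      (simp add: mult.commute mult.left_commute nn_integral_cmult)
  interpret D: prob_space ?D
    by (rule prob_spaceI) (use D[of "\<lambda>_. 1"] Z Z_top in \<open>simp add: less_top\<close>)
  have laplace: "(\<integral>\<^sup>+ m. nexp (\<integral>\<^sup>+ x. g x \<partial>m) \<partial>?D) = nexp (\<integral>\<^sup>+ x. 1 - nexp (g x) \<partial>?L)"
    if g [measurable]: "g \<in> borel_measurable L" for g
  proof -
    have split: "1 - nexp (H x + g x) = (1 - nexp (H x)) + nexp (H x) * (1 - nexp (g x))" for x
    proof -
      obtain a b where ab: "nexp (H x) = ennreal a" "nexp (g x) = ennreal b" "0 \<le> a" "0 \<le> b"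
        by (metis nexp_neq_top(1) ennreal_cases)
      then have le: "a \<le> 1" "b \<le> 1"
        using nexp_le_1[of "H x"] nexp_le_1[of "g x"] by auto
      have "1 - nexp (H x + g x) = ennreal ((1 - a) + a * (1 - b))"
        using ab by (simp add: nexp_add ennreal_minus right_diff_distrib flip: ennreal_1 ennreal_mult)
      also have "\<dots> = ennreal (1 - a) + ennreal a * ennreal (1 - b)"
        using ab le by (subst ennreal_plus) (auto simp: ennreal_mult)
      also have "\<dots> = (1 - nexp (H x)) + nexp (H x) * (1 - nexp (g x))"
        using ab by (simp add: ennreal_minus flip: ennreal_1)
      finally show ?thesis .
    qed
    have "(\<integral>\<^sup>+ m. nexp (\<integral>\<^sup>+ x. H x \<partial>m) * nexp (\<integral>\<^sup>+ x. g x \<partial>m) \<partial>Q) =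
        (\<integral>\<^sup>+ m. nexp (\<integral>\<^sup>+ x. H x + g x \<partial>m) \<partial>Q)"
    proof (rule nn_integral_cong)
      fix m assume "m \<in> space Q"
      then have [measurable_cong]: "sets m = sets L" by (rule Q.sets_N)
      have "(\<integral>\<^sup>+ x. H x + g x \<partial>m) = (\<integral>\<^sup>+ x. H x \<partial>m) + (\<integral>\<^sup>+ x. g x \<partial>m)"
        by (rule nn_integral_add) measurable
      then show "nexp (\<integral>\<^sup>+ x. H x \<partial>m) * nexp (\<integral>\<^sup>+ x. g x \<partial>m) = nexp (\<integral>\<^sup>+ x. H x + g x \<partial>m)"
        by (simp add: nexp_add)
    qed
    also have "\<dots> = nexp (\<integral>\<^sup>+ x. 1 - nexp (H x + g x) \<partial>L)"
      by (rule Q.laplace) measurable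
    also have "\<dots> = nexp ((\<integral>\<^sup>+ x. 1 - nexp (H x) \<partial>L) + (\<integral>\<^sup>+ x. nexp (H x) * (1 - nexp (g x)) \<partial>L))"
      unfolding split by (subst nn_integral_add) measurable
    \<comment> \<open>The first integral contributes exactly the factor \<open>Z\<close>, by the
      Laplace formula for \<open>H\<close>, and the normalization removes it. The second one is the
      integral of 1 - exp(-g) against the tilted intensity.\<close>
    also have "\<dots> = nexp (\<integral>\<^sup>+ x. 1 - nexp (g x) \<partial>?L) * Z"
      by (simp add: nexp_add Z(1) Q.laplace nn_integral_density mult.commute)
    finally show ?thesis
      using Z(2) Z_top by (simp add: D mult_divide_eq_ennreal)
  qed
  show ?thesis
  proof
    show "(\<lambda>m. m) \<in> ?D \<rightarrow>\<^sub>M measure_algebra ?L"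
      using measure_algebra_cong[of ?L L] by simp
    show "AE m in ?D. emeasure m A \<in> extended_nats" if "A \<in> sets ?L" for A
      using Q.AE_extended_nats that by (intro AE_densityI) auto
  qed (simp add: laplace)
qed

section \<open>The intensity\<close>

lemma space_intensity [simp]: "space (intensity \<rho> \<eta>) = UNIV"
  unfolding intensity_def by (rule space_measure_of) simp

lemma sets_intensity [measurable_cong, simp]:
  "sets (intensity \<rho> \<eta>) = sets (borel \<Otimes>\<^sub>M borel)"
  using sets.sigma_sets_eq[of "borel \<Otimes>\<^sub>M borel"]
  unfolding intensity_def by (simp add: sets_measure_of space_pair_measure)

lemma sets_section:
  assumes A: "A \<in> sets (borel \<Otimes>\<^sub>M borel)"
  shows "{s. (s, y) \<in> A} \<in> sets borel"
proof -
  have "(\<lambda>s. (s, y)) -` A \<inter> space borel \<in> sets borel"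
    using A by (intro measurable_sets[of _ borel "borel \<Otimes>\<^sub>M borel"]) auto
  then show ?thesis by (simp add: vimage_def)
qed

lemma measurable_section:
  assumes "sets R = sets borel" and f: "f \<in> borel_measurable (borel \<Otimes>\<^sub>M borel)"
  shows "(\<lambda>s. f (s, y)) \<in> borel_measurable R"
proof -
  have "(\<lambda>s. f (s, y)) \<in> borel_measurable borel"
    by (rule measurable_compose[OF measurable_Pair2' f]) simp
  then show ?thesis by (simp add: assms(1) cong: measurable_cong_sets)
qed

text \<open>Induction from rectangles over complements and disjoint unions. Restricting to a set
  \<open>D\<close> of finite mass is what makes the complement step a legitimate
  subtraction.\<close>

lemma measurable_kernel_section_finite:
  fixes \<rho> :: "'y::topological_space \<Rightarrow> 's::topological_space measure"
  assumes sets: "\<And>y. sets (\<rho> y) = sets borel"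
    and meas: "\<And>B. B \<in> sets borel \<Longrightarrow> (\<lambda>y. emeasure (\<rho> y) B) \<in> borel_measurable borel"
    and D: "D \<in> sets borel" "\<And>y. emeasure (\<rho> y) D < \<infinity>"
    and A: "A \<in> sets (borel \<Otimes>\<^sub>M borel)"
  shows "(\<lambda>y. emeasure (\<rho> y) ({s. (s, y) \<in> A} \<inter> D)) \<in> borel_measurable borel"
proof -
  let ?G = "{a \<times> b | a b. a \<in> sets (borel :: 's measure) \<and> b \<in> sets (borel :: 'y measure)}"
  have A': "A \<in> sigma_sets (UNIV \<times> UNIV) ?G"
    using A by (simp add: sets_pair_measure)
  have G: "sigma_sets (UNIV \<times> UNIV) ?G = sets (borel \<Otimes>\<^sub>M borel)"
    by (simp add: sets_pair_measure)
  show ?thesis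
  proof (rule sigma_sets_induct_disjoint[OF Int_stable_pair_measure_generator[of borel borel, simplified] _ A'])
    show "?G \<subseteq> Pow (UNIV \<times> UNIV)" by auto
    show "(\<lambda>y. emeasure (\<rho> y) ({s. (s, y) \<in> {}} \<inter> D)) \<in> borel_measurable borel" by simp
  next
    fix X assume "X \<in> ?G"
    then obtain a b where ab: "X = a \<times> b" "a \<in> sets borel" "b \<in> sets borel" by auto
    then have [measurable]: "(\<lambda>y. emeasure (\<rho> y) (a \<inter> D)) \<in> borel_measurable borel"
      using D by (intro meas) auto
    have "emeasure (\<rho> y) ({s. (s, y) \<in> X} \<inter> D) = emeasure (\<rho> y) (a \<inter> D) * indicator b y" for y
      by (cases "y \<in> b") (auto simp: ab)
    then show "(\<lambda>y. emeasure (\<rho> y) ({s. (s, y) \<in> X} \<inter> D)) \<in> borel_measurable borel"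
      using ab(3) by simp
  next
    fix X assume X: "X \<in> sigma_sets (UNIV \<times> UNIV) ?G"
      and [measurable]: "(\<lambda>y. emeasure (\<rho> y) ({s. (s, y) \<in> X} \<inter> D)) \<in> borel_measurable borel"
    have [measurable]: "(\<lambda>y. emeasure (\<rho> y) D) \<in> borel_measurable borel"
      using D by (intro meas) auto
    have "emeasure (\<rho> y) ({s. (s, y) \<in> UNIV \<times> UNIV - X} \<inter> D) =
        emeasure (\<rho> y) D - emeasure (\<rho> y) ({s. (s, y) \<in> X} \<inter> D)" for y
    proof -
      have S: "{s. (s, y) \<in> X} \<inter> D \<in> sets (\<rho> y)"
        using X D unfolding G sets by (intro sets.Int sets_section)
      have "emeasure (\<rho> y) ({s. (s, y) \<in> X} \<inter> D) \<le> emeasure (\<rho> y) D"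
        using D sets by (intro emeasure_mono) auto
      then have "emeasure (\<rho> y) ({s. (s, y) \<in> X} \<inter> D) \<noteq> \<infinity>"
        using D(2)[of y] by (auto simp: top_unique)
      then have "emeasure (\<rho> y) (D - {s. (s, y) \<in> X} \<inter> D) =
          emeasure (\<rho> y) D - emeasure (\<rho> y) ({s. (s, y) \<in> X} \<inter> D)"
        using S D sets by (intro emeasure_Diff) auto
      moreover have "{s. (s, y) \<in> UNIV \<times> UNIV - X} \<inter> D = D - {s. (s, y) \<in> X} \<inter> D" by auto
      ultimately show ?thesis by simp
    qed
    then show "(\<lambda>y. emeasure (\<rho> y) ({s. (s, y) \<in> UNIV \<times> UNIV - X} \<inter> D)) \<in> borel_measurable borel"
      by simp
  next
    fix X :: "nat \<Rightarrow> _" assume X: "disjoint_family X" "range X \<subseteq> sigma_sets (UNIV \<times> UNIV) ?G"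
      and [measurable]: "\<And>i. (\<lambda>y. emeasure (\<rho> y) ({s. (s, y) \<in> X i} \<inter> D)) \<in> borel_measurable borel"
    have "emeasure (\<rho> y) ({s. (s, y) \<in> \<Union>(range X)} \<inter> D) =
        (\<Sum>i. emeasure (\<rho> y) ({s. (s, y) \<in> X i} \<inter> D))" for y
    proof -
      have "range (\<lambda>i. {s. (s, y) \<in> X i} \<inter> D) \<subseteq> sets (\<rho> y)"
        using X(2) D unfolding G sets by (auto intro!: sets.Int sets_section)
      moreover have "disjoint_family (\<lambda>i. {s. (s, y) \<in> X i} \<inter> D)"
        using X(1) by (auto simp: disjoint_family_on_def)
      ultimately have "(\<Sum>i. emeasure (\<rho> y) ({s. (s, y) \<in> X i} \<inter> D)) =
          emeasure (\<rho> y) (\<Union>i. {s. (s, y) \<in> X i} \<inter> D)"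
        by (rule suminf_emeasure)
      moreover have "{s. (s, y) \<in> \<Union>(range X)} \<inter> D = (\<Union>i. {s. (s, y) \<in> X i} \<inter> D)" by auto
      ultimately show ?thesis by simp
    qed
    then show "(\<lambda>y. emeasure (\<rho> y) ({s. (s, y) \<in> \<Union>(range X)} \<inter> D)) \<in> borel_measurable borel"
      by simp
  qed
qed

text \<open>The cover in \<open>levy_kernel\<close> is the same for all y. Made disjoint, it writes
  the section mass as a series of the finite pieces just treated.\<close>

lemma measurable_kernel_section:
  fixes \<rho> :: "'y::topological_space \<Rightarrow> 's::topological_space measure"
  assumes rho: "levy_kernel \<rho>" and A: "A \<in> sets (borel \<Otimes>\<^sub>M borel)"
  shows "(\<lambda>y. emeasure (\<rho> y) {s. (s, y) \<in> A}) \<in> borel_measurable borel"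
proof -
  have sets: "sets (\<rho> y) = sets borel" for y
    using rho by (auto simp: levy_kernel_def)
  have meas: "B \<in> sets borel \<Longrightarrow> (\<lambda>y. emeasure (\<rho> y) B) \<in> borel_measurable borel" for B
    using rho by (auto simp: levy_kernel_def)
  obtain C :: "nat \<Rightarrow> 's set" where C: "range C \<subseteq> sets borel" "(\<Union>k. C k) = UNIV"
    "\<And>k y. emeasure (\<rho> y) (C k) < \<infinity>"
    using rho by (auto simp: levy_kernel_def)
  define D where "D = disjointed C"
  have D: "D k \<in> sets borel" "disjoint_family D" "(\<Union>k. D k) = UNIV" for k
    using C sets.range_disjointed_sets[OF C(1)]
    by (auto simp: D_def disjoint_family_disjointed UN_disjointed_eq)
  have D_fin: "emeasure (\<rho> y) (D k) < \<infinity>" for k y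
  proof -
    have "emeasure (\<rho> y) (D k) \<le> emeasure (\<rho> y) (C k)"
      using C(1) sets by (intro emeasure_mono) (auto simp: D_def dest: disjointed_subset[THEN subsetD])
    with C(3)[of y k] show ?thesis by (rule le_less_trans[rotated])
  qed
  have [measurable]: "(\<lambda>y. emeasure (\<rho> y) ({s. (s, y) \<in> A} \<inter> D k)) \<in> borel_measurable borel" for k
    by (rule measurable_kernel_section_finite[OF sets meas D(1) D_fin A])
  have "emeasure (\<rho> y) {s. (s, y) \<in> A} = (\<Sum>k. emeasure (\<rho> y) ({s. (s, y) \<in> A} \<inter> D k))" for y
  proof -
    have "range (\<lambda>k. {s. (s, y) \<in> A} \<inter> D k) \<subseteq> sets (\<rho> y)"
      using D(1) sets_section[OF A] sets by (auto intro!: sets.Int)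
    moreover have "disjoint_family (\<lambda>k. {s. (s, y) \<in> A} \<inter> D k)"
      using D(2) by (auto simp: disjoint_family_on_def)
    ultimately have "(\<Sum>k. emeasure (\<rho> y) ({s. (s, y) \<in> A} \<inter> D k)) =
        emeasure (\<rho> y) (\<Union>k. {s. (s, y) \<in> A} \<inter> D k)"
      by (rule suminf_emeasure)
    moreover have "(\<Union>k. {s. (s, y) \<in> A} \<inter> D k) = {s. (s, y) \<in> A}"
      using D(3) by auto
    ultimately show ?thesis by simp
  qed
  then show ?thesis by simp
qed

text \<open>\<open>measure_of\<close> returns the given set function only if it is countably
  additive; this follows by exchanging sum and integral, for which the sections have to be
  measurable in y.\<close>

lemma emeasure_intensity:
  assumes eta: "sets \<eta> = sets borel" and rho: "levy_kernel \<rho>" and A: "A \<in> sets (borel \<Otimes>\<^sub>M borel)"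
  shows "emeasure (intensity \<rho> \<eta>) A = (\<integral>\<^sup>+ y. emeasure (\<rho> y) {s. (s, y) \<in> A} \<partial>\<eta>)"
proof -
  note [measurable_cong] = eta
  have sets: "sets (\<rho> y) = sets borel" for y
    using rho by (auto simp: levy_kernel_def)
  note [measurable] = measurable_kernel_section[OF rho]
  have "countably_additive (sets (intensity \<rho> \<eta>)) (\<lambda>A. \<integral>\<^sup>+ y. emeasure (\<rho> y) {s. (s, y) \<in> A} \<partial>\<eta>)"
  proof (rule countably_additiveI)
    fix X :: "nat \<Rightarrow> _" assume "range X \<subseteq> sets (intensity \<rho> \<eta>)" and disj: "disjoint_family X"
    then have X: "X i \<in> sets (borel \<Otimes>\<^sub>M borel)" for i by auto
    have "(\<Sum>i. \<integral>\<^sup>+ y. emeasure (\<rho> y) {s. (s, y) \<in> X i} \<partial>\<eta>) =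
        (\<integral>\<^sup>+ y. (\<Sum>i. emeasure (\<rho> y) {s. (s, y) \<in> X i}) \<partial>\<eta>)"
      using measurable_kernel_section[OF rho X] by (subst nn_integral_suminf) simp_all
    also have "\<dots> = (\<integral>\<^sup>+ y. emeasure (\<rho> y) {s. (s, y) \<in> \<Union>(range X)} \<partial>\<eta>)"
    proof (rule nn_integral_cong)
      fix y
      have "range (\<lambda>i. {s. (s, y) \<in> X i}) \<subseteq> sets (\<rho> y)"
        using sets_section[OF X] sets by auto
      moreover have "disjoint_family (\<lambda>i. {s. (s, y) \<in> X i})"
        using disj by (auto simp: disjoint_family_on_def)
      ultimately have "(\<Sum>i. emeasure (\<rho> y) {s. (s, y) \<in> X i}) =
          emeasure (\<rho> y) (\<Union>i. {s. (s, y) \<in> X i})"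
        by (rule suminf_emeasure)
      moreover have "(\<Union>i. {s. (s, y) \<in> X i}) = {s. (s, y) \<in> \<Union>(range X)}" by auto
      ultimately show "(\<Sum>i. emeasure (\<rho> y) {s. (s, y) \<in> X i}) =
          emeasure (\<rho> y) {s. (s, y) \<in> \<Union>(range X)}" by simp
    qed
    finally show "(\<Sum>i. \<integral>\<^sup>+ y. emeasure (\<rho> y) {s. (s, y) \<in> X i} \<partial>\<eta>) =
        (\<integral>\<^sup>+ y. emeasure (\<rho> y) {s. (s, y) \<in> \<Union>(range X)} \<partial>\<eta>)" .
  qed
  then show ?thesis
    using A by (intro emeasure_measure_of[OF intensity_def]) (auto simp: positive_def)
qed

text \<open>Fubini for a kernel. Measurability of the inner integral is carried along in the
  conclusion because the sum and limit steps of the induction need it.\<close>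

lemma nn_integral_intensity:
  assumes eta: "sets \<eta> = sets borel" and rho: "levy_kernel \<rho>"
    and f: "f \<in> borel_measurable (borel \<Otimes>\<^sub>M borel)"
  shows "(\<lambda>y. \<integral>\<^sup>+ s. f (s, y) \<partial>\<rho> y) \<in> borel_measurable borel \<and>
    (\<integral>\<^sup>+ x. f x \<partial>intensity \<rho> \<eta>) = (\<integral>\<^sup>+ y. \<integral>\<^sup>+ s. f (s, y) \<partial>\<rho> y \<partial>\<eta>)"
  using f
proof induct
  case (cong f g)
  have "f = g"
    by (rule ext) (use cong in \<open>simp add: space_pair_measure\<close>)
  with cong show ?case by simp
next
  case (set A)
  have [measurable_cong]: "sets (\<rho> y) = sets borel" for y
    using rho by (auto simp: levy_kernel_def)
  have "(\<integral>\<^sup>+ s. indicator A (s, y) \<partial>\<rho> y) = emeasure (\<rho> y) {s. (s, y) \<in> A}" for y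
  proof -
    have "(\<integral>\<^sup>+ s. indicator A (s, y) \<partial>\<rho> y) = (\<integral>\<^sup>+ s. indicator {s. (s, y) \<in> A} s \<partial>\<rho> y)"
      by (intro nn_integral_cong) (auto simp: indicator_def)
    then show ?thesis
      using sets_section[OF set, of y] by simp
  qed
  with set show ?case
    using measurable_kernel_section[OF rho set] emeasure_intensity[OF eta rho set] by simp
next
  case (mult u c)
  have m: "(\<lambda>s. u (s, y)) \<in> borel_measurable (\<rho> y)" for y
    using rho mult by (intro measurable_section) (auto simp: levy_kernel_def)
  have "(\<lambda>y. \<integral>\<^sup>+ s. u (s, y) \<partial>\<rho> y) \<in> borel_measurable \<eta>"
    using mult eta by (simp cong: measurable_cong_sets)
  with mult m show ?case
    by (auto simp: nn_integral_cmult intro!: borel_measurable_times cong: measurable_cong_sets)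
next
  case (add u v)
  have m: "(\<lambda>s. u (s, y)) \<in> borel_measurable (\<rho> y)" "(\<lambda>s. v (s, y)) \<in> borel_measurable (\<rho> y)" for y
    using rho add by (intro measurable_section; auto simp: levy_kernel_def)+
  have "(\<lambda>y. \<integral>\<^sup>+ s. u (s, y) \<partial>\<rho> y) \<in> borel_measurable \<eta>" "(\<lambda>y. \<integral>\<^sup>+ s. v (s, y) \<partial>\<rho> y) \<in> borel_measurable \<eta>"
    using add eta by (simp_all cong: measurable_cong_sets)
  with add m show ?case
    by (auto simp: nn_integral_add intro!: borel_measurable_add cong: measurable_cong_sets)
next
  case (seq F)
  have m: "(\<lambda>s. F i (s, y)) \<in> borel_measurable (\<rho> y)" for i y
    using rho seq by (intro measurable_section) (auto simp: levy_kernel_def)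
  have inc: "incseq (\<lambda>i s. F i (s, y))" for y
    using seq by (auto simp: incseq_def le_fun_def)
  have eq: "(\<integral>\<^sup>+ s. (SUP i. F i) (s, y) \<partial>\<rho> y) = (SUP i. \<integral>\<^sup>+ s. F i (s, y) \<partial>\<rho> y)" for y
    unfolding SUP_apply by (rule nn_integral_monotone_convergence_SUP[OF inc m])
  have me: "(\<lambda>y. \<integral>\<^sup>+ s. F i (s, y) \<partial>\<rho> y) \<in> borel_measurable \<eta>" for i
    using seq eta by (simp cong: measurable_cong_sets)
  have inc': "incseq (\<lambda>i y. \<integral>\<^sup>+ s. F i (s, y) \<partial>\<rho> y)"
    using inc by (auto simp: incseq_def le_fun_def intro!: nn_integral_mono)
  have "(\<integral>\<^sup>+ x. (SUP i. F i) x \<partial>intensity \<rho> \<eta>) = (SUP i. \<integral>\<^sup>+ x. F i x \<partial>intensity \<rho> \<eta>)"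
    unfolding SUP_apply using seq
    by (intro nn_integral_monotone_convergence_SUP) (auto cong: measurable_cong_sets)
  also have "\<dots> = (SUP i. \<integral>\<^sup>+ y. \<integral>\<^sup>+ s. F i (s, y) \<partial>\<rho> y \<partial>\<eta>)"
    using seq by simp
  also have "\<dots> = (\<integral>\<^sup>+ y. (SUP i. \<integral>\<^sup>+ s. F i (s, y) \<partial>\<rho> y) \<partial>\<eta>)"
    by (rule nn_integral_monotone_convergence_SUP[symmetric, OF inc' me])
  finally show ?case
    unfolding eq using seq by (auto intro!: borel_measurable_SUP)
qed

lemma sigma_finite_intensity:
  fixes \<rho> :: "'y::topological_space \<Rightarrow> 's::topological_space measure"
  assumes eta: "sets \<eta> = sets borel" "sigma_finite_measure \<eta>" and rho: "levy_kernel \<rho>"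
  shows "sigma_finite_measure (intensity \<rho> \<eta>)"
proof -
  interpret eta: sigma_finite_measure \<eta> by fact
  have meas: "B \<in> sets borel \<Longrightarrow> (\<lambda>y. emeasure (\<rho> y) B) \<in> borel_measurable borel" for B
    using rho by (auto simp: levy_kernel_def)
  obtain C :: "nat \<Rightarrow> 's set" where C: "range C \<subseteq> sets borel" "(\<Union>k. C k) = UNIV"
    "\<And>k y. emeasure (\<rho> y) (C k) < \<infinity>"
    using rho by (auto simp: levy_kernel_def)
  obtain E :: "nat \<Rightarrow> 'y set" where E: "range E \<subseteq> sets \<eta>" "(\<Union>i. E i) = space \<eta>"
    "\<And>i. emeasure \<eta> (E i) \<noteq> \<infinity>"
    using eta.sigma_finite by metis
  have [simp]: "space \<eta> = UNIV" using sets_eq_imp_space_eq[OF eta(1)] by simp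
  \<comment> \<open>The mass of \<open>C k\<close> under \<rho>(.|y) is finite for each y but not
    bounded in y, so the y-space is also cut at the level m. The rectangle
    \<open>C k \<times> B k j m\<close> then has mass at most m \<eta>(E j).\<close>
  define B where "B k j m = E j \<inter> {y. emeasure (\<rho> y) (C k) \<le> of_nat m}" for k j m :: nat
  have B_sets: "B k j m \<in> sets borel" for k j m
  proof -
    have [measurable]: "(\<lambda>y. emeasure (\<rho> y) (C k)) \<in> borel_measurable borel"
      using C(1) by (intro meas) auto
    have [measurable]: "E j \<in> sets borel" using E(1) eta(1) by auto
    show ?thesis unfolding B_def by measurable
  qed
  have CB: "C k \<times> B k j m \<in> sets (borel \<Otimes>\<^sub>M borel)" for k j m
    using C(1) B_sets by auto
  show ?thesis
  proof
    let ?F = "range (\<lambda>(k, j, m). C k \<times> B k j m)"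
    have "\<Union>?F = UNIV"
    proof safe
      fix s :: 's and y :: 'y
      from C(2) obtain k where "s \<in> C k" by blast
      moreover from E(2) obtain j where "y \<in> E j" by auto
      moreover obtain m :: nat where "emeasure (\<rho> y) (C k) < of_nat m"
        using ennreal_Ex_less_of_nat[of "emeasure (\<rho> y) (C k)"] C(3)[of y k] by auto
      ultimately have "(s, y) \<in> C k \<times> B k j m" by (auto simp: B_def)
      then show "(s, y) \<in> \<Union>?F" by force
    qed simp
    moreover have "emeasure (intensity \<rho> \<eta>) (C k \<times> B k j m) \<noteq> \<infinity>" for k j m
    proof -
      have "emeasure (intensity \<rho> \<eta>) (C k \<times> B k j m) =
          (\<integral>\<^sup>+ y. emeasure (\<rho> y) {s. (s, y) \<in> C k \<times> B k j m} \<partial>\<eta>)"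
        by (rule emeasure_intensity[OF eta(1) rho CB])
      also have "\<dots> \<le> (\<integral>\<^sup>+ y. of_nat m * indicator (E j) y \<partial>\<eta>)"
      proof (rule nn_integral_mono)
        fix y
        show "emeasure (\<rho> y) {s. (s, y) \<in> C k \<times> B k j m} \<le> of_nat m * indicator (E j) y"
          by (cases "y \<in> B k j m") (auto simp: B_def)
      qed
      also have "\<dots> = of_nat m * emeasure \<eta> (E j)"
        using E(1) by (intro nn_integral_cmult_indicator) auto
      also have "\<dots> < \<infinity>"
        using E(3)[of j] by (simp add: ennreal_mult_less_top less_top of_nat_less_top)
      finally show ?thesis by simp
    qed
    ultimately show "\<exists>A. countable A \<and> A \<subseteq> sets (intensity \<rho> \<eta>) \<and> \<Union>A = space (intensity \<rho> \<eta>) \<and>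
        (\<forall>a\<in>A. emeasure (intensity \<rho> \<eta>) a \<noteq> \<infinity>)"
      using CB by (intro exI[of _ ?F]) auto
  qed
qed

text \<open>Both sides are \<open>measure_of\<close> constructions on one sigma-algebra, so it
  suffices that the set functions agree there. The weight is put into the form exp(-H) with H(s, y)
  = v h(s), as the tilting result requires.\<close>

lemma intensity_exp_tilt:
  assumes eta: "sets \<eta> = sets borel" and rho: "levy_kernel \<rho>"
    and h: "h \<in> borel_measurable borel" "\<And>s. 0 < h s" and v: "0 \<le> v"
  shows "intensity (exp_tilt v h \<rho>) \<eta> =
    density (intensity \<rho> \<eta>) (\<lambda>x. nexp (ennreal v * ennreal (h (fst x))))"
proof -
  note [measurable] = h(1)
  have nx: "nexp (ennreal v * ennreal (h s)) = ennreal (exp (- v * h s))" for s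
    using h(2)[of s] v by (simp add: nexp_ennreal flip: ennreal_mult)
  have eq: "(\<integral>\<^sup>+ y. emeasure (exp_tilt v h \<rho> y) {s. (s, y) \<in> A} \<partial>\<eta>) =
      (\<integral>\<^sup>+ x. nexp (ennreal v * ennreal (h (fst x))) * indicator A x \<partial>intensity \<rho> \<eta>)"
    if [measurable]: "A \<in> sets (borel \<Otimes>\<^sub>M borel)" for A
  proof -
    have sets [measurable_cong]: "sets (\<rho> y) = sets borel" for y
      using rho by (auto simp: levy_kernel_def)
    have "emeasure (exp_tilt v h \<rho> y) {s. (s, y) \<in> A} =
        (\<integral>\<^sup>+ s. nexp (ennreal v * ennreal (h (fst (s, y)))) * indicator A (s, y) \<partial>\<rho> y)" for y
      using sets_section[OF that, of y] unfolding exp_tilt_def fst_conv nx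
      by (subst emeasure_density) (auto simp: sets indicator_def intro!: nn_integral_cong)
    then show ?thesis
      using nn_integral_intensity[OF eta rho,
        of "\<lambda>x. nexp (ennreal v * ennreal (h (fst x))) * indicator A x"] by simp
  qed
  have "sigma_sets UNIV (sets (borel \<Otimes>\<^sub>M borel :: ('b \<times> 'a) measure)) = sets (borel \<Otimes>\<^sub>M borel)"
    using sets.sigma_sets_eq[of "borel \<Otimes>\<^sub>M borel :: ('b \<times> 'a) measure"] by (simp add: space_pair_measure)
  then show ?thesis
    unfolding density_def space_intensity sets_intensity
    by (subst intensity_def, intro measure_of_eq) (auto simp: eq)
qed

section \<open>Negative powers and extended integrals\<close>

lemma borel_measurable_exp_neg [measurable (raw)]:
  assumes [measurable]: "f \<in> borel_measurable M"
  shows "(\<lambda>x. exp_neg (f x)) \<in> borel_measurable M"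
proof -
  have "exp_neg x = (if x < \<infinity> then if -\<infinity> < x then ennreal (exp (- real_of_ereal x)) else \<infinity> else 0)" for x
    by (auto simp: exp_neg_def)
  then show ?thesis by simp
qed

lemma borel_measurable_neg_power [measurable (raw)]:
  assumes [measurable]: "f \<in> borel_measurable M"
  shows "(\<lambda>x. neg_power \<theta> (f x)) \<in> borel_measurable M"
proof -
  have "neg_power \<theta> x =
      (if x \<le> 0 then \<infinity> else if x < \<infinity> then ennreal (real_of_ereal x powr (- \<theta>)) else 0)" for x
    by (auto simp: neg_power_def)
  then show ?thesis by simp
qed

lemma exp_neg_add: "exp_neg (ereal r + x) = ennreal (exp (- r)) * exp_neg x"
  by (cases x) (auto simp: exp_neg_def mult_exp_exp ennreal_mult_top simp flip: ennreal_mult)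

lemma exp_neg_ge_1: "x \<le> 0 \<Longrightarrow> 1 \<le> exp_neg x"
  by (cases x) (auto simp: exp_neg_def)

text \<open>Homogeneity, used to merge T^{-\<theta>} and (1 + Pg)^{-\<theta>} into (T +
  \<mu>(g))^{-\<theta>}. The positive finite factor \<open>t\<close> keeps the sign of x, and with
  it the infinite values.\<close>

lemma neg_power_mult:
  assumes "0 < t" "x \<noteq> -\<infinity>"
  shows "neg_power \<theta> (ereal t) * neg_power \<theta> x = neg_power \<theta> (ereal t * x)"
proof (cases x)
  case (real r)
  show ?thesis
  proof (cases "r \<le> 0")
    case True
    then have "t * r \<le> 0" using assms by (simp add: mult_nonneg_nonpos)
    with True real assms show ?thesis
      by (auto simp: neg_power_def ennreal_mult_top zero_ereal_def)
  next
    case False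
    then have "0 < t * r" using assms by (intro mult_pos_pos) auto
    with False show ?thesis
      using real assms by (auto simp: neg_power_def powr_mult zero_ereal_def mult_le_0_iff simp flip: ennreal_mult)
  qed
qed (use assms in \<open>auto simp: neg_power_def\<close>)

text \<open>For finite x > 0 this is Euler's integral after the substitution t = x v. For x \<le> 0
  the exponential factor is at least 1, so the integral dominates \<Gamma>(\<theta>) r^{-\<theta>}
  for every r > 0 and is infinite.\<close>

lemma Gamma_mult_neg_power:
  assumes \<theta>: "0 < \<theta>"
  shows "ennreal (Gamma \<theta>) * neg_power \<theta> x =
    (\<integral>\<^sup>+ v. ennreal (v powr (\<theta> - 1)) * exp_neg (ereal v * x) * indicator {0<..} v \<partial>lborel)"
proof -
  have G: "0 < Gamma \<theta>" using \<theta> by (rule Gamma_real_pos)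
  have pos: "ennreal (Gamma \<theta>) * ennreal (x powr (- \<theta>)) =
      (\<integral>\<^sup>+ v. ennreal (v powr (\<theta> - 1)) * exp_neg (ereal v * ereal x) * indicator {0<..} v \<partial>lborel)"
    if x: "0 < x" for x :: real
  proof -
    let ?I = "\<integral>\<^sup>+ v. ennreal (v powr (\<theta> - 1)) * exp_neg (ereal v * ereal x) * indicator {0<..} v \<partial>lborel"
    have "ennreal (Gamma \<theta>) = (\<integral>\<^sup>+ t. ennreal (indicator {0..} t * t powr (\<theta> - 1) / exp t) \<partial>lborel)"
      by (rule Gamma_conv_nn_integral_real[OF \<theta>])
    also have "\<dots> = ennreal \<bar>x\<bar> *
        (\<integral>\<^sup>+ v. ennreal (indicator {0..} (0 + x * v) * (0 + x * v) powr (\<theta> - 1) / exp (0 + x * v)) \<partial>lborel)"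
      using x by (intro nn_integral_real_affine) auto
    also have "(\<integral>\<^sup>+ v. ennreal (indicator {0..} (0 + x * v) * (0 + x * v) powr (\<theta> - 1) / exp (0 + x * v)) \<partial>lborel) =
        (\<integral>\<^sup>+ v. ennreal (x powr (\<theta> - 1)) *
          (ennreal (v powr (\<theta> - 1)) * exp_neg (ereal v * ereal x) * indicator {0<..} v) \<partial>lborel)"
    proof (rule nn_integral_cong)
      fix v :: real
      \<comment> \<open>At v = 0 the indicators of the closed and the open half-line differ, but the
        left side is 0 as well because \<open>0 powr a = 0\<close>.\<close>
      consider "v < 0" | "v = 0" | "0 < v" by linarith
      then show "ennreal (indicator {0..} (0 + x * v) * (0 + x * v) powr (\<theta> - 1) / exp (0 + x * v)) =
          ennreal (x powr (\<theta> - 1)) * (ennreal (v powr (\<theta> - 1)) * exp_neg (ereal v * ereal x) * indicator {0<..} v)"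
      proof cases
        case 1
        then have "\<not> 0 \<le> x * v" using x by (simp add: zero_le_mult_iff)
        with 1 show ?thesis by simp
      next
        case 3
        with x show ?thesis
          by (simp add: exp_neg_def powr_mult exp_minus field_simps flip: ennreal_mult)
      qed (use x in simp)
    qed
    also have "\<dots> = ennreal (x powr (\<theta> - 1)) * ?I"
      by (rule nn_integral_cmult) measurable
    finally have "ennreal (Gamma \<theta>) = ennreal (x * x powr (\<theta> - 1)) * ?I"
      using x by (simp add: ennreal_mult mult.assoc)
    also have "x * x powr (\<theta> - 1) = x powr \<theta>"
      using x powr_add[of x 1 "\<theta> - 1"] by simp
    finally have "ennreal (x powr (- \<theta>)) * ennreal (Gamma \<theta>) = ennreal (x powr (- \<theta>)) * ennreal (x powr \<theta>) * ?I"
      by (simp add: mult.assoc)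
    also have "ennreal (x powr (- \<theta>)) * ennreal (x powr \<theta>) = 1"
      using x by (simp flip: ennreal_mult powr_add)
    finally show ?thesis by (simp add: mult.commute)
  qed
  consider "x = \<infinity>" | r where "x = ereal r" "0 < r" | "x \<le> 0"
    by (cases x) (auto simp: zero_ereal_def, meson not_le)
  then show ?thesis
  proof cases
    case 1
    have "(\<integral>\<^sup>+ v. ennreal (v powr (\<theta> - 1)) * exp_neg (ereal v * x) * indicator {0<..} v \<partial>lborel) = (\<integral>\<^sup>+ (v::real). 0 \<partial>lborel)"
      unfolding 1 by (intro nn_integral_cong) (auto simp: exp_neg_def indicator_def)
    then show ?thesis using 1 by (simp add: neg_power_def)
  next
    case 2
    with pos[of r] show ?thesis by (simp add: neg_power_def)
  next
    case 3
    let ?I = "\<integral>\<^sup>+ v. ennreal (v powr (\<theta> - 1)) * exp_neg (ereal v * x) * indicator {0<..} v \<partial>lborel"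
    have ge: "ennreal (Gamma \<theta>) * ennreal (r powr (- \<theta>)) \<le> ?I" if "0 < r" for r
      unfolding pos[OF that]
    proof (rule nn_integral_mono)
      fix v :: real
      have "exp_neg (ereal v * ereal r) \<le> exp_neg (ereal v * x)" if v: "0 < v"
      proof -
        have "exp_neg (ereal v * ereal r) \<le> 1" using v \<open>0 < r\<close> by (simp add: exp_neg_def)
        also have "1 \<le> exp_neg (ereal v * x)"
          using v 3 by (intro exp_neg_ge_1) (simp add: ereal_mult_le_0_iff)
        finally show ?thesis .
      qed
      then show "ennreal (v powr (\<theta> - 1)) * exp_neg (ereal v * ereal r) * indicator {0<..} v
          \<le> ennreal (v powr (\<theta> - 1)) * exp_neg (ereal v * x) * indicator {0<..} v"
        by (auto simp: indicator_def intro!: mult_left_mono)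
    qed
    have "?I = \<infinity>"
    proof (rule ccontr)
      assume "?I \<noteq> \<infinity>"
      then obtain j where j: "?I = ennreal j" "0 \<le> j" by (cases ?I) auto
      \<comment> \<open>The solution of \<Gamma>(\<theta>) r^{-\<theta>} = j + 1, one more than the
        supposed finite value j of the integral.\<close>
      define r where "r = ((j + 1) / Gamma \<theta>) powr (- 1 / \<theta>)"
      have "0 < r" using j G by (simp add: r_def)
      moreover have "r powr (- \<theta>) = (j + 1) / Gamma \<theta>"
        using \<theta> j G by (simp add: r_def powr_powr)
      ultimately have "ennreal (j + 1) \<le> ennreal j"
        using ge[of r] G j by (simp flip: ennreal_mult)
      with j show False by simp
    qed
    with 3 G show ?thesis by (simp add: neg_power_def ennreal_mult_top)
  qed
qed

section \<open>Linearity of extended-real integrals\<close>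

lemma ext_integral_scale_measure:
  assumes "0 \<le> v" and [measurable]: "g \<in> borel_measurable m"
  shows "ext_integral (scale_measure (ennreal v) m) g = ext_integral m (\<lambda>y. v * g y)"
proof -
  have "ennreal (- (v * g y)) = ennreal v * ennreal (- g y)" for y
    using assms ennreal_mult'[of v "- g y"] by simp
  with assms show ?thesis
    by (simp add: ext_integral_def nn_integral_scale_measure ennreal_mult' nn_integral_cmult)
qed

lemma ext_integral_cmult_eq:
  assumes "0 \<le> v" and [measurable]: "g \<in> borel_measurable m"
  shows "ext_integral m (\<lambda>y. v * g y) =
    enn2ereal (ennreal v * (\<integral>\<^sup>+ y. ennreal (g y) \<partial>m)) - enn2ereal (ennreal v * (\<integral>\<^sup>+ y. ennreal (- g y) \<partial>m))"
  using assms ext_integral_scale_measure[OF assms]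
  by (simp add: ext_integral_def nn_integral_scale_measure)

lemma ext_integral_cmult:
  assumes v: "0 \<le> v" and g: "g \<in> borel_measurable m" and fin: "(\<integral>\<^sup>+ y. ennreal (- g y) \<partial>m) < \<infinity>"
  shows "ext_integral m (\<lambda>y. v * g y) = ereal v * ext_integral m g"
proof -
  define a b where "a = (\<integral>\<^sup>+ y. ennreal (g y) \<partial>m)" and "b = (\<integral>\<^sup>+ y. ennreal (- g y) \<partial>m)"
  have "enn2ereal (ennreal v * a) - enn2ereal (ennreal v * b) = ereal v * (enn2ereal a - enn2ereal b)"
    using v fin[folded b_def]
    by (cases a; cases b; cases "v = 0")
      (auto simp: ennreal_mult_top algebra_simps simp flip: ennreal_mult)
  then show ?thesis
    by (simp only: ext_integral_cmult_eq[OF v g]) (simp only: ext_integral_def a_def b_def)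
qed

text \<open>With positive and negative parts, (f+g)^+ + f^- + g^- = (f+g)^- + f^+ + g^+ holds
  pointwise and integrates without subtraction. The three negative parts have finite integrals and
  may then be moved across.\<close>

lemma ext_integral_add:
  assumes [measurable]: "f \<in> borel_measurable m" "g \<in> borel_measurable m"
    and f: "(\<integral>\<^sup>+ y. ennreal (- f y) \<partial>m) < \<infinity>" and g: "(\<integral>\<^sup>+ y. ennreal (- g y) \<partial>m) < \<infinity>"
  shows "ext_integral m (\<lambda>y. f y + g y) = ext_integral m f + ext_integral m g"
    and "(\<integral>\<^sup>+ y. ennreal (- (f y + g y)) \<partial>m) < \<infinity>"
proof -
  have "(\<integral>\<^sup>+ y. ennreal (- (f y + g y)) \<partial>m) \<le> (\<integral>\<^sup>+ y. ennreal (- f y) + ennreal (- g y) \<partial>m)"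
  proof (rule nn_integral_mono)
    fix y
    show "ennreal (- (f y + g y)) \<le> ennreal (- f y) + ennreal (- g y)"
      by (cases "f y \<le> 0"; cases "g y \<le> 0") (auto simp: ennreal_neg simp flip: ennreal_plus intro!: ennreal_leI)
  qed
  also have "\<dots> = (\<integral>\<^sup>+ y. ennreal (- f y) \<partial>m) + (\<integral>\<^sup>+ y. ennreal (- g y) \<partial>m)"
    by (rule nn_integral_add) measurable
  also have "\<dots> < \<infinity>" using f g by simp
  finally show fg: "(\<integral>\<^sup>+ y. ennreal (- (f y + g y)) \<partial>m) < \<infinity>" .
  have "ennreal (f y + g y) + ennreal (- f y) + ennreal (- g y) =
      ennreal (- (f y + g y)) + ennreal (f y) + ennreal (g y)" for y
    by (cases "f y \<le> 0"; cases "g y \<le> 0"; cases "f y + g y \<le> 0")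
      (auto simp: ennreal_neg simp flip: ennreal_plus)
  then have "(\<integral>\<^sup>+ y. ennreal (f y + g y) + ennreal (- f y) + ennreal (- g y) \<partial>m) =
      (\<integral>\<^sup>+ y. ennreal (- (f y + g y)) + ennreal (f y) + ennreal (g y) \<partial>m)"
    by (simp only:)
  then have "(\<integral>\<^sup>+ y. ennreal (f y + g y) \<partial>m) + (\<integral>\<^sup>+ y. ennreal (- f y) \<partial>m) + (\<integral>\<^sup>+ y. ennreal (- g y) \<partial>m) =
      (\<integral>\<^sup>+ y. ennreal (- (f y + g y)) \<partial>m) + (\<integral>\<^sup>+ y. ennreal (f y) \<partial>m) + (\<integral>\<^sup>+ y. ennreal (g y) \<partial>m)"
    by (simp add: nn_integral_add)
  then show "ext_integral m (\<lambda>y. f y + g y) = ext_integral m f + ext_integral m g"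
    unfolding ext_integral_def using f g fg
    by (cases "\<integral>\<^sup>+ y. ennreal (f y + g y) \<partial>m"; cases "\<integral>\<^sup>+ y. ennreal (- (f y + g y)) \<partial>m";
        cases "\<integral>\<^sup>+ y. ennreal (f y) \<partial>m"; cases "\<integral>\<^sup>+ y. ennreal (- f y) \<partial>m";
        cases "\<integral>\<^sup>+ y. ennreal (g y) \<partial>m"; cases "\<integral>\<^sup>+ y. ennreal (- g y) \<partial>m")
      (auto simp flip: ennreal_plus)
qed

lemma ext_integral_sum:
  assumes "finite I" and meas: "\<And>l. l \<in> I \<Longrightarrow> f l \<in> borel_measurable m"
    and z: "\<And>l. l \<in> I \<Longrightarrow> 0 \<le> z l"
    and fin: "\<And>l. l \<in> I \<Longrightarrow> (\<integral>\<^sup>+ y. ennreal (- f l y) \<partial>m) < \<infinity>"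
  shows "ext_integral m (\<lambda>y. \<Sum>l\<in>I. z l * f l y) = (\<Sum>l\<in>I. ereal (z l) * ext_integral m (f l)) \<and>
    (\<integral>\<^sup>+ y. ennreal (- (\<Sum>l\<in>I. z l * f l y)) \<partial>m) < \<infinity>"
  using assms
proof (induction I rule: finite_induct)
  case empty
  then show ?case by (simp add: ext_integral_def)
next
  case (insert j I)
  have fj: "f j \<in> borel_measurable m" "0 \<le> z j" "(\<integral>\<^sup>+ y. ennreal (- f j y) \<partial>m) < \<infinity>"
    using insert.prems by auto
  have "ennreal (- (z j * f j y)) = ennreal (z j) * ennreal (- f j y)" for y
    using fj(2) ennreal_mult'[of "z j" "- f j y"] by simp
  then have fin: "(\<integral>\<^sup>+ y. ennreal (- (z j * f j y)) \<partial>m) < \<infinity>"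
    using fj by (simp add: nn_integral_cmult ennreal_mult_less_top)
  have meas: "(\<lambda>y. z j * f j y) \<in> borel_measurable m" "(\<lambda>y. \<Sum>l\<in>I. z l * f l y) \<in> borel_measurable m"
    using insert.prems(1) by (auto intro!: borel_measurable_sum borel_measurable_times)
  have IH: "ext_integral m (\<lambda>y. \<Sum>l\<in>I. z l * f l y) = (\<Sum>l\<in>I. ereal (z l) * ext_integral m (f l))"
    "(\<integral>\<^sup>+ y. ennreal (- (\<Sum>l\<in>I. z l * f l y)) \<partial>m) < \<infinity>"
    using insert.IH insert.prems by auto
  show ?case
    using ext_integral_add[OF meas fin IH(2)] IH(1) ext_integral_cmult[OF fj(2,1,3)] insert.hyps
    by simp
qed

lemma ext_integral_neq_MInf: "(\<integral>\<^sup>+ y. ennreal (- g y) \<partial>m) < \<infinity> \<Longrightarrow> ext_integral m g \<noteq> -\<infinity>"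
  unfolding ext_integral_def
  by (cases "\<integral>\<^sup>+ y. ennreal (g y) \<partial>m"; cases "\<integral>\<^sup>+ y. ennreal (- g y) \<partial>m") auto

section \<open>The normalized random measure\<close>

lemma sets_mu [simp, measurable_cong]: "sets (mu h n) = sets borel"
  and space_mu [simp]: "space (mu h n) = UNIV"
  by (simp_all add: mu_def)

lemma nn_integral_mu:
  fixes n :: "('s::topological_space \<times> 'y::topological_space) measure"
  assumes n: "sets n = sets (borel \<Otimes>\<^sub>M borel)" and h [measurable]: "h \<in> borel_measurable borel"
    and g [measurable]: "g \<in> borel_measurable borel"
  shows "(\<integral>\<^sup>+ y. g y \<partial>mu h n) = (\<integral>\<^sup>+ x. ennreal (h (fst x)) * g (snd x) \<partial>n)"
proof -
  note [measurable_cong] = n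
  have d: "density n (\<lambda>(s, y). ennreal (h s)) = density n (\<lambda>x. ennreal (h (fst x)))"
    by (simp add: case_prod_beta')
  show ?thesis
    unfolding mu_def d by (subst nn_integral_distr) (auto simp: nn_integral_density)
qed

lemma total_mass_eq:
  fixes n :: "('s::topological_space \<times> 'y::topological_space) measure"
  assumes n: "sets n = sets (borel \<Otimes>\<^sub>M borel)" and h: "h \<in> borel_measurable borel"
  shows "total_mass h n = (\<integral>\<^sup>+ x. ennreal (h (fst x)) \<partial>n)"
  using nn_integral_mu[OF n h, of "\<lambda>_. 1"] by (simp add: total_mass_def)

lemma measurable_mu [measurable]:
  assumes [measurable]: "h \<in> borel_measurable borel"
  shows "mu h \<in> measure_algebra (borel \<Otimes>\<^sub>M borel) \<rightarrow>\<^sub>M measure_algebra borel"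
proof (rule measurable_measure_algebra)
  fix B :: "'b set" assume [measurable]: "B \<in> sets borel"
  have "(\<lambda>n. \<integral>\<^sup>+ x. ennreal (h (fst x)) * indicator B (snd x) \<partial>n)
      \<in> borel_measurable (measure_algebra (borel \<Otimes>\<^sub>M borel))"
    by (rule nn_integral_measurable_measure_algebra) measurable
  moreover have "emeasure (mu h n) B = (\<integral>\<^sup>+ x. ennreal (h (fst x)) * indicator B (snd x) \<partial>n)"
    if "n \<in> space (measure_algebra (borel \<Otimes>\<^sub>M borel))" for n
    using that nn_integral_mu[of n h "indicator B"] by (simp add: space_measure_algebra)
  ultimately show "(\<lambda>n. emeasure (mu h n) B) \<in> borel_measurable (measure_algebra (borel \<Otimes>\<^sub>M borel))"
    by (subst measurable_cong) auto
qed simp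

lemma measurable_total_mass [measurable]:
  assumes "h \<in> borel_measurable borel"
  shows "total_mass h \<in> borel_measurable (measure_algebra (borel \<Otimes>\<^sub>M borel))"
  unfolding total_mass_def[abs_def]
  by (rule measurable_compose[OF measurable_mu[OF assms] measurable_emeasure_measure_algebra]) simp

lemma measurable_normalized_mu [measurable]:
  assumes h: "h \<in> borel_measurable borel"
  shows "normalized_mu h \<in> measure_algebra (borel \<Otimes>\<^sub>M borel) \<rightarrow>\<^sub>M subprob_algebra borel"
proof (rule measurable_subprob_algebra)
  fix n :: "('a \<times> 'b) measure"
  show "subprob_space (normalized_mu h n)"
  proof (rule subprob_spaceI)
    \<comment> \<open>The product is 1 except for t = 0 and t = \<infinity>, where it is 0:
      degenerate totals give mass zero, so the value is a subprobability for every
      realization.\<close>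
    have "inverse t * t \<le> 1" for t :: ennreal
      by (cases t; cases "t = 0")
        (auto simp: inverse_ennreal ennreal_mult_top simp flip: ennreal_mult)
    then show "emeasure (normalized_mu h n) (space (normalized_mu h n)) \<le> 1"
      by (simp add: normalized_mu_def total_mass_def space_scale_measure)
  qed (simp add: normalized_mu_def space_scale_measure)
  show "sets (normalized_mu h n) = sets borel"
    by (simp add: normalized_mu_def)
next
  fix B :: "'b set" assume B: "B \<in> sets borel"
  have [measurable]: "(\<lambda>n. emeasure (mu h n) B) \<in> borel_measurable (measure_algebra (borel \<Otimes>\<^sub>M borel))"
    by (rule measurable_compose[OF measurable_mu[OF h] measurable_emeasure_measure_algebra[OF B]])
  have [measurable]: "total_mass h \<in> borel_measurable (measure_algebra (borel \<Otimes>\<^sub>M borel))"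
    by (rule measurable_total_mass[OF h])
  show "(\<lambda>n. emeasure (normalized_mu h n) B) \<in> borel_measurable (measure_algebra (borel \<Otimes>\<^sub>M borel))"
    unfolding normalized_mu_def emeasure_scale_measure by measurable
qed

lemma measurable_ext_integral:
  assumes [measurable]: "g \<in> borel_measurable K"
  shows "(\<lambda>m. ext_integral m g) \<in> borel_measurable (measure_algebra K)"
    and "(\<lambda>m. ext_integral m g) \<in> borel_measurable (subprob_algebra K)"
proof -
  have [measurable]: "(\<lambda>m. \<integral>\<^sup>+ y. ennreal (u y) \<partial>m) \<in> borel_measurable (measure_algebra K)"
    if "u \<in> borel_measurable K" for u
    using that by (intro nn_integral_measurable_measure_algebra) measurable
  show "(\<lambda>m. ext_integral m g) \<in> borel_measurable (measure_algebra K)"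
    "(\<lambda>m. ext_integral m g) \<in> borel_measurable (subprob_algebra K)"
    unfolding ext_integral_def by measurable
qed

lemma measurable_scale_measure:
  assumes [measurable]: "c \<in> borel_measurable M" and F: "F \<in> M \<rightarrow>\<^sub>M measure_algebra K"
  shows "(\<lambda>x. scale_measure (c x) (F x)) \<in> M \<rightarrow>\<^sub>M measure_algebra K"
proof (rule measurable_measure_algebra)
  show "sets (scale_measure (c x) (F x)) = sets K" if "x \<in> space M" for x
    using measurable_space[OF F that] by (simp add: space_measure_algebra)
  fix A assume "A \<in> sets K"
  then have [measurable]: "(\<lambda>x. emeasure (F x) A) \<in> borel_measurable M"
    using measurable_compose[OF F measurable_emeasure_measure_algebra] by blast
  show "(\<lambda>x. emeasure (scale_measure (c x) (F x)) A) \<in> borel_measurable M"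
    by simp
qed

section \<open>Exponential tilting of the canonical law and the law of V \<mu>_V\<close>

text \<open>The setting without the underlying probability space: N is the identity under its own
  law \<open>Q\<close>. All tilted laws can then be compared as densities with respect to the one
  law \<open>Q\<close>.\<close>

locale normalized_poisson =
  fixes \<rho> :: "'y::topological_space \<Rightarrow> 's::topological_space measure" and \<eta> :: "'y measure" and h :: "'s \<Rightarrow> real"
  assumes eta: "sets \<eta> = sets borel" "sigma_finite_measure \<eta>"
    and rho: "levy_kernel \<rho>"
    and h: "h \<in> borel_measurable borel" "\<And>s. 0 < h s"
    and poisson: "poisson_laplace (P_law \<rho> \<eta>) (\<lambda>n. n) (intensity \<rho> \<eta>)"
    and sets_law: "sets (P_law \<rho> \<eta>) = sets (measure_algebra (borel \<Otimes>\<^sub>M borel))"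
    and T_finite: "AE n in P_law \<rho> \<eta>. total_mass h n < \<infinity>"
begin

abbreviation "Q \<equiv> P_law \<rho> \<eta>"
abbreviation "T \<equiv> total_mass h"

sublocale Q: poisson_laplace Q "\<lambda>n. n" "intensity \<rho> \<eta>"
  by (rule poisson)

lemmas [measurable_cong] = sets_law
lemmas [measurable] = h(1)

lemma sets_realization: "n \<in> space Q \<Longrightarrow> sets n = sets (borel \<Otimes>\<^sub>M borel)"
  using sets_eq_imp_space_eq[OF sets_law] by (simp add: space_measure_algebra)

lemma T_measurable [measurable]: "T \<in> borel_measurable Q"
  using measurable_total_mass[OF h(1)] by (simp cong: measurable_cong_sets add: sets_law)

lemma mu_measurable [measurable]: "mu h \<in> Q \<rightarrow>\<^sub>M measure_algebra borel"
  using measurable_mu[OF h(1)] by (simp cong: measurable_cong_sets add: sets_law)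

text \<open>E[exp(-vT)], which appears twice: as the normalizing constant of the tilted law and as a
  factor in the density of \<pi>_\<theta>.\<close>

definition Z :: "real \<Rightarrow> ennreal" where
  "Z v = (\<integral>\<^sup>+ n. nexp (ennreal v * T n) \<partial>Q)"

lemma Z_measurable [measurable]: "Z \<in> borel_measurable borel"
  unfolding Z_def[abs_def] by measurable

text \<open>Positivity comes from almost sure finiteness of T, which makes exp(-vT) positive;
  finiteness holds because the integrand is at most 1.\<close>

lemma Z_neq: "0 \<le> v \<Longrightarrow> Z v \<noteq> 0" "Z v \<noteq> top"
proof -
  show "Z v \<noteq> 0" if v: "0 \<le> v"
  proof
    assume "Z v = 0"
    then have "AE n in Q. nexp (ennreal v * T n) = 0"
      unfolding Z_def by (subst (asm) nn_integral_0_iff_AE) auto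
    with T_finite have "AE n in Q. False"
      by eventually_elim (auto simp: ennreal_mult_eq_top_iff)
    then show False by simp
  qed
  have "Z v \<le> (\<integral>\<^sup>+ n. 1 \<partial>Q)"
    unfolding Z_def by (intro nn_integral_mono nexp_le_1)
  then show "Z v \<noteq> top" by (auto simp: Q.emeasure_space_1 top_unique)
qed

text \<open>The integral of v h(s) against a realization n is v T(n), so this is the tilting result
  with H = v h. The left side is a definite description, and the density is shown to be the law it
  describes.\<close>

lemma P_law_exp_tilt:
  assumes v: "0 \<le> v"
  shows "P_law (exp_tilt v h \<rho>) \<eta> = density Q (\<lambda>n. nexp (ennreal v * T n) / Z v)"
    and "prob_space (density Q (\<lambda>n. nexp (ennreal v * T n) / Z v))"
proof -
  let ?H = "\<lambda>x :: 's \<times> 'y. ennreal v * ennreal (h (fst x))"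
  have H [measurable]: "?H \<in> borel_measurable (intensity \<rho> \<eta>)"
    by measurable
  have int: "(\<integral>\<^sup>+ x. ?H x \<partial>n) = ennreal v * T n" if "n \<in> space Q" for n
  proof -
    note n = sets_realization[OF that]
    note [measurable_cong] = n
    show ?thesis
      unfolding total_mass_eq[OF n h(1)] by (rule nn_integral_cmult) measurable
  qed
  have Z: "Z v = (\<integral>\<^sup>+ n. nexp (\<integral>\<^sup>+ x. ?H x \<partial>n) \<partial>Q)"
    unfolding Z_def using int by (intro nn_integral_cong) simp
  have D: "density Q (\<lambda>n. nexp (\<integral>\<^sup>+ x. ?H x \<partial>n) / Z v) = density Q (\<lambda>n. nexp (ennreal v * T n) / Z v)"
  proof (rule density_cong)
    have [measurable]: "(\<lambda>n. \<integral>\<^sup>+ x. ?H x \<partial>n) \<in> borel_measurable Q"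
      using nn_integral_measurable_measure_algebra[of ?H "borel \<Otimes>\<^sub>M borel"]
      by (simp cong: measurable_cong_sets add: sets_law)
    show "(\<lambda>n. nexp (\<integral>\<^sup>+ x. ?H x \<partial>n) / Z v) \<in> borel_measurable Q" by measurable
    show "AE n in Q. nexp (\<integral>\<^sup>+ x. ?H x \<partial>n) / Z v = nexp (ennreal v * T n) / Z v"
      using int by (intro AE_I2) simp
  qed measurable
  have sQ: "sets Q = sets (measure_algebra (intensity \<rho> \<eta>))"
    by (simp add: sets_law measure_algebra_cong[OF sets_intensity])
  have pl: "poisson_laplace (density Q (\<lambda>n. nexp (ennreal v * T n) / Z v)) (\<lambda>n. n)
      (intensity (exp_tilt v h \<rho>) \<eta>)"
    using poisson_laplace_density[OF poisson sQ H Z Z_neq(1)[OF v]]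
    unfolding D intensity_exp_tilt[OF eta(1) rho h v] .
  then show "prob_space (density Q (\<lambda>n. nexp (ennreal v * T n) / Z v))"
    by (simp add: poisson_laplace_def)
  \<comment> \<open>A density that is nowhere infinite preserves sigma-finiteness.\<close>
  have "sigma_finite_measure (intensity (exp_tilt v h \<rho>) \<eta>)"
  proof -
    interpret I: sigma_finite_measure "intensity \<rho> \<eta>"
      by (rule sigma_finite_intensity[OF eta rho])
    show ?thesis
      unfolding intensity_exp_tilt[OF eta(1) rho h v]
      by (subst I.sigma_finite_iff_density_finite) auto
  qed
  moreover have "sets (density Q (\<lambda>n. nexp (ennreal v * T n) / Z v)) =
      sets (measure_algebra (intensity (exp_tilt v h \<rho>) \<eta>))"
    by (simp add: sets_law measure_algebra_cong[OF sets_intensity])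
  ultimately show "P_law (exp_tilt v h \<rho>) \<eta> = density Q (\<lambda>n. nexp (ennreal v * T n) / Z v)"
    unfolding P_law_def[of "exp_tilt v h \<rho>"] using pl by (intro poisson_law_eqI)
qed

text \<open>Multiplied by \<open>Z v\<close> rather than divided by it: in this form the factor
  \<open>Z v\<close> of \<pi>_\<theta> is absorbed directly.\<close>

lemma nn_integral_P_law_exp_tilt:
  assumes v: "0 \<le> v" and [measurable]: "u \<in> borel_measurable Q"
  shows "Z v * (\<integral>\<^sup>+ n. u n \<partial>P_law (exp_tilt v h \<rho>) \<eta>) = (\<integral>\<^sup>+ n. nexp (ennreal v * T n) * u n \<partial>Q)"
proof -
  have "(\<integral>\<^sup>+ n. u n \<partial>P_law (exp_tilt v h \<rho>) \<eta>) = (\<integral>\<^sup>+ n. (nexp (ennreal v * T n) * u n) / Z v \<partial>Q)"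
    unfolding P_law_exp_tilt(1)[OF v]
    by (subst nn_integral_density) (auto simp: divide_ennreal_def mult_ac)
  also have "\<dots> = (\<integral>\<^sup>+ n. nexp (ennreal v * T n) * u n \<partial>Q) / Z v"
    by (rule nn_integral_divide) measurable
  finally show ?thesis
    using Z_neq[of v] v by (simp add: mult.commute[of "Z v"] ennreal_divide_times less_top)
qed

lemma measurable_mu_P_law_exp_tilt [measurable]:
  "0 \<le> v \<Longrightarrow> mu h \<in> P_law (exp_tilt v h \<rho>) \<eta> \<rightarrow>\<^sub>M measure_algebra borel"
  by (simp add: P_law_exp_tilt(1))

lemma laplace_functional_mu_law_exp_tilt:
  assumes v: "0 \<le> v" and g [measurable]: "g \<in> borel_measurable borel"
  shows "Z v * laplace_functional (mu_law h (exp_tilt v h \<rho>) \<eta>) g =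
    (\<integral>\<^sup>+ n. nexp (ennreal v * T n) * exp_neg (ext_integral (mu h n) g) \<partial>Q)"
proof -
  note [measurable] = measurable_ext_integral(1)[OF g]
  have "laplace_functional (mu_law h (exp_tilt v h \<rho>) \<eta>) g =
      (\<integral>\<^sup>+ n. exp_neg (ext_integral (mu h n) g) \<partial>P_law (exp_tilt v h \<rho>) \<eta>)"
    unfolding laplace_functional_def mu_law_def using v
    by (subst nn_integral_distr) measurable
  then show ?thesis
    using nn_integral_P_law_exp_tilt[OF v, of "\<lambda>n. exp_neg (ext_integral (mu h n) g)"] by simp
qed

lemma pi_law_eq:
  "pi_law h \<rho> \<eta> \<theta> = density (restrict_space lborel {0<..})
    (\<lambda>v. ennreal (v powr (\<theta> - 1)) * Z v / (ennreal (Gamma \<theta>) * T_moment h \<rho> \<eta> \<theta>))"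
  unfolding pi_law_def
proof (rule density_cong)
  have eq: "(\<integral>\<^sup>+ n. exp_neg (ereal v * enn2ereal (T n)) \<partial>Q) = Z v" if "0 < v" for v
  proof -
    have "ereal v * enn2ereal t = enn2ereal (ennreal v * t)" for t
      using that by (simp add: times_ennreal.rep_eq)
    then show ?thesis by (simp add: Z_def exp_neg_enn2ereal)
  qed
  let ?d = "\<lambda>v. ennreal (v powr (\<theta> - 1)) * Z v / (ennreal (Gamma \<theta>) * T_moment h \<rho> \<eta> \<theta>)"
  show d: "?d \<in> borel_measurable (restrict_space lborel {0<..})"
    by (intro measurable_restrict_space1) measurable
  show "(\<lambda>v. ennreal (v powr (\<theta> - 1)) * (\<integral>\<^sup>+ n. exp_neg (ereal v * enn2ereal (T n)) \<partial>Q) /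
      (ennreal (Gamma \<theta>) * T_moment h \<rho> \<eta> \<theta>)) \<in> borel_measurable (restrict_space lborel {0<..})"
    by (subst measurable_cong[where g = ?d]) (use d in \<open>auto simp: eq space_restrict_space\<close>)
  show "AE v in restrict_space lborel {0<..}.
      ennreal (v powr (\<theta> - 1)) * (\<integral>\<^sup>+ n. exp_neg (ereal v * enn2ereal (T n)) \<partial>Q) /
        (ennreal (Gamma \<theta>) * T_moment h \<rho> \<eta> \<theta>) = ?d v"
    by (rule AE_I2) (simp add: eq space_restrict_space)
qed

lemma space_pi_law: "space (pi_law h \<rho> \<eta> \<theta>) = {0<..}"
  by (simp add: pi_law_def space_restrict_space)

lemma nn_integral_pi_law:
  assumes u: "u \<in> borel_measurable (restrict_space lborel {0<..})"
  shows "(\<integral>\<^sup>+ v. u v \<partial>pi_law h \<rho> \<eta> \<theta>) =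
    (\<integral>\<^sup>+ v. ennreal (v powr (\<theta> - 1)) * (Z v * u v) * indicator {0<..} v \<partial>lborel)
      / (ennreal (Gamma \<theta>) * T_moment h \<rho> \<eta> \<theta>)"
proof -
  have meas: "(\<lambda>v::real. ennreal (v powr (\<theta> - 1))) \<in> borel_measurable (restrict_space lborel {0<..})"
    "Z \<in> borel_measurable (restrict_space lborel {0<..})"
    by (rule measurable_restrict_space1; measurable)+
  have "(\<integral>\<^sup>+ v. u v \<partial>pi_law h \<rho> \<eta> \<theta>) =
      (\<integral>\<^sup>+ v. ennreal (v powr (\<theta> - 1)) * (Z v * u v) / (ennreal (Gamma \<theta>) * T_moment h \<rho> \<eta> \<theta>)
        \<partial>restrict_space lborel {0<..})"
    unfolding pi_law_eq using u meas by (subst nn_integral_density) (auto simp: divide_ennreal_def mult_ac)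
  also have "\<dots> = (\<integral>\<^sup>+ v. ennreal (v powr (\<theta> - 1)) * (Z v * u v) \<partial>restrict_space lborel {0<..})
      / (ennreal (Gamma \<theta>) * T_moment h \<rho> \<eta> \<theta>)"
    by (rule nn_integral_divide) (use meas u in \<open>auto intro!: borel_measurable_times_ennreal\<close>)
  also have "(\<integral>\<^sup>+ v. ennreal (v powr (\<theta> - 1)) * (Z v * u v) \<partial>restrict_space lborel {0<..}) =
      (\<integral>\<^sup>+ v. ennreal (v powr (\<theta> - 1)) * (Z v * u v) * indicator {0<..} v \<partial>lborel)"
    by (rule nn_integral_restrict_space) simp
  finally show ?thesis .
qed

text \<open>Required to integrate against the \<open>bind\<close> in \<open>V_mu_V_law\<close>.
  Although the tilted law changes with v, each kernel value is a quotient I v / Z v of parameter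
  integrals over the fixed law \<open>Q\<close>, so joint measurability in (v, n) suffices.\<close>

lemma measurable_V_mu_V_kernel:
  "(\<lambda>v. distr (mu_law h (exp_tilt v h \<rho>) \<eta>) (measure_algebra borel) (scale_measure (ennreal v)))
    \<in> pi_law h \<rho> \<eta> \<theta> \<rightarrow>\<^sub>M subprob_algebra (measure_algebra borel)" (is "?K \<in> _")
proof (rule measurable_subprob_algebra)
  have scale [measurable]: "scale_measure c \<in> measure_algebra borel \<rightarrow>\<^sub>M (measure_algebra borel :: 'y measure measure)" for c
    by (rule measurable_scale_measure) simp_all
  fix v assume "v \<in> space (pi_law h \<rho> \<eta> \<theta>)"
  then have v: "0 \<le> v" by (simp add: space_pi_law)
  interpret P: prob_space "P_law (exp_tilt v h \<rho>) \<eta>"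
    using P_law_exp_tilt[OF v] by simp
  have "prob_space (?K v)"
    unfolding mu_law_def using v
    by (intro prob_space.prob_space_distr P.prob_space_distr) measurable
  then show "subprob_space (?K v)" by (rule prob_space_imp_subprob_space)
next
  fix A :: "'y measure set" assume A [measurable]: "A \<in> sets (measure_algebra borel)"
  have scale [measurable]: "scale_measure c \<in> measure_algebra borel \<rightarrow>\<^sub>M (measure_algebra borel :: 'y measure measure)" for c
    by (rule measurable_scale_measure) simp_all
  have joint: "(\<lambda>(v, n). scale_measure (ennreal v) (mu h n)) \<in> borel \<Otimes>\<^sub>M Q \<rightarrow>\<^sub>M measure_algebra borel"
    unfolding case_prod_beta' by (rule measurable_scale_measure) measurable
  have [measurable]: "(\<lambda>x. indicator A (scale_measure (ennreal (fst x)) (mu h (snd x))) :: ennreal)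
      \<in> borel_measurable (borel \<Otimes>\<^sub>M Q)"
    using measurable_compose[OF joint borel_measurable_indicator[OF A]] by (simp add: case_prod_beta')
  define I where "I v = (\<integral>\<^sup>+ n. nexp (ennreal v * T n) * indicator A (scale_measure (ennreal v) (mu h n)) \<partial>Q)" for v
  have [measurable]: "I \<in> borel_measurable borel"
    unfolding I_def[abs_def] by (rule Q.borel_measurable_nn_integral) (simp add: case_prod_beta')
  have "emeasure (?K v) A = I v / Z v" if "v \<in> space (pi_law h \<rho> \<eta> \<theta>)" for v
  proof -
    have v: "0 \<le> v" using that by (simp add: space_pi_law)
    have "emeasure (?K v) A = (\<integral>\<^sup>+ m. indicator A m \<partial>?K v)"
      by simp
    also have "\<dots> = (\<integral>\<^sup>+ n. indicator A (scale_measure (ennreal v) (mu h n)) \<partial>P_law (exp_tilt v h \<rho>) \<eta>)"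
      unfolding mu_law_def using v
      by (subst nn_integral_distr, measurable)+
    also have "\<dots> = I v / Z v"
      using nn_integral_P_law_exp_tilt[OF v, of "\<lambda>n. indicator A (scale_measure (ennreal v) (mu h n))"] Z_neq[of v] v
      unfolding I_def by (simp add: mult.commute[of "Z v"]) (metis mult_divide_eq_ennreal)
    finally show ?thesis .
  qed
  moreover have "(\<lambda>v. I v / Z v) \<in> borel_measurable (pi_law h \<rho> \<eta> \<theta>)"
  proof -
    have "(\<lambda>v. I v / Z v) \<in> borel_measurable (restrict_space lborel {0<..})"
      by (intro measurable_restrict_space1) measurable
    then show ?thesis by (simp add: pi_law_def cong: measurable_cong_sets)
  qed
  ultimately show "(\<lambda>v. emeasure (?K v) A) \<in> borel_measurable (pi_law h \<rho> \<eta> \<theta>)"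
    by (subst measurable_cong) auto
qed simp

text \<open>Integration against the mixture is iterated, and scaling a measure by v has the same
  effect on the integral as scaling \<open>g\<close>.\<close>

lemma laplace_functional_V_mu_V_law:
  assumes g [measurable]: "g \<in> borel_measurable borel"
  shows "laplace_functional (V_mu_V_law h \<rho> \<eta> \<theta>) g =
    (\<integral>\<^sup>+ v. laplace_functional (mu_law h (exp_tilt v h \<rho>) \<eta>) (\<lambda>y. v * g y) \<partial>pi_law h \<rho> \<eta> \<theta>)"
proof -
  note [measurable] = measurable_ext_integral(1)[OF g]
  have scale [measurable]: "scale_measure c \<in> measure_algebra borel \<rightarrow>\<^sub>M (measure_algebra borel :: 'y measure measure)" for c
    by (rule measurable_scale_measure) simp_all
  have "laplace_functional (V_mu_V_law h \<rho> \<eta> \<theta>) g =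
      (\<integral>\<^sup>+ v. \<integral>\<^sup>+ m. exp_neg (ext_integral m g)
        \<partial>distr (mu_law h (exp_tilt v h \<rho>) \<eta>) (measure_algebra borel) (scale_measure (ennreal v)) \<partial>pi_law h \<rho> \<eta> \<theta>)"
    unfolding laplace_functional_def V_mu_V_law_def
    by (rule nn_integral_bind[OF _ measurable_V_mu_V_kernel]) measurable
  also have "\<dots> = (\<integral>\<^sup>+ v. laplace_functional (mu_law h (exp_tilt v h \<rho>) \<eta>) (\<lambda>y. v * g y) \<partial>pi_law h \<rho> \<eta> \<theta>)"
  proof (rule nn_integral_cong)
    fix v assume "v \<in> space (pi_law h \<rho> \<eta> \<theta>)"
    then have v: "0 \<le> v" by (simp add: space_pi_law)
    have "(\<integral>\<^sup>+ m. exp_neg (ext_integral m g)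
        \<partial>distr (mu_law h (exp_tilt v h \<rho>) \<eta>) (measure_algebra borel) (scale_measure (ennreal v))) =
      (\<integral>\<^sup>+ m. exp_neg (ext_integral (scale_measure (ennreal v) m) g) \<partial>mu_law h (exp_tilt v h \<rho>) \<eta>)"
      unfolding mu_law_def by (subst nn_integral_distr) measurable
    also have "\<dots> = (\<integral>\<^sup>+ m. exp_neg (ext_integral m (\<lambda>y. v * g y)) \<partial>mu_law h (exp_tilt v h \<rho>) \<eta>)"
    proof (rule nn_integral_cong)
      fix m assume "m \<in> space (mu_law h (exp_tilt v h \<rho>) \<eta>)"
      then have "sets m = sets borel" by (simp add: mu_law_def space_measure_algebra)
      then have "g \<in> borel_measurable m" using g by (simp cong: measurable_cong_sets)
      then show "exp_neg (ext_integral (scale_measure (ennreal v) m) g) = exp_neg (ext_integral m (\<lambda>y. v * g y))"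
        by (simp add: ext_integral_scale_measure[OF v])
    qed
    finally show "(\<integral>\<^sup>+ m. exp_neg (ext_integral m g)
        \<partial>distr (mu_law h (exp_tilt v h \<rho>) \<eta>) (measure_algebra borel) (scale_measure (ennreal v))) =
      laplace_functional (mu_law h (exp_tilt v h \<rho>) \<eta>) (\<lambda>y. v * g y)"
      by (simp add: laplace_functional_def)
  qed
  finally show ?thesis .
qed

end

section \<open>The negative moment as a mixture over v\<close>

context normalized_poisson
begin

context
  fixes \<theta> :: real
  assumes \<theta>: "0 < \<theta>" and moment_finite: "T_moment h \<rho> \<eta> \<theta> < \<infinity>"
begin

text \<open>\<open>neg_power\<close> is infinite at 0, so an atom of T at 0 would make the moment
  infinite.\<close>

lemma AE_T_pos: "AE n in Q. 0 < T n"
proof -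
  have "AE n in Q. neg_power \<theta> (enn2ereal (T n)) \<noteq> \<infinity>"
    using moment_finite by (intro nn_integral_PInf_AE) (auto simp: T_moment_def)
  then show ?thesis
    by eventually_elim (auto simp: neg_power_def zero_less_iff_neq_zero zero_ennreal.rep_eq split: if_splits)
qed

text \<open>For almost every realization, the Gamma integral is applied to T (1 + PF) = T +
  \<mu>(F). Integrating over \<open>Q\<close> and exchanging the order leaves, for each v, the
  tilted expectation \<open>Z v * K v\<close>, which is what the density of \<pi>_\<theta> calls
  for. The value \<infinity> is allowed on both sides.\<close>

lemma mixture_representation:
  assumes F [measurable]: "F \<in> borel_measurable borel"
    and neg: "AE n in Q. (\<integral>\<^sup>+ y. ennreal (- F y) \<partial>normalized_mu h n) < \<infinity>"
  shows "(\<integral>\<^sup>+ n. neg_power \<theta> (enn2ereal (T n)) / T_moment h \<rho> \<eta> \<theta>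
      * neg_power \<theta> (1 + ext_integral (normalized_mu h n) F) \<partial>Q) =
    (\<integral>\<^sup>+ v. laplace_functional (mu_law h (exp_tilt v h \<rho>) \<eta>) (\<lambda>y. v * F y) \<partial>pi_law h \<rho> \<eta> \<theta>)"
proof -
  let ?m = "T_moment h \<rho> \<eta> \<theta>"
  have G: "0 < Gamma \<theta>" using \<theta> by (rule Gamma_real_pos)
  have mu_int [measurable]: "(\<lambda>n. \<integral>\<^sup>+ y. g y \<partial>mu h n) \<in> borel_measurable Q" if "g \<in> borel_measurable borel" for g
    using measurable_compose[OF mu_measurable nn_integral_measurable_measure_algebra[OF that]] .
  \<comment> \<open>The exponential of -v \<mu>(F), written with v outside the integrals of the
    positive and negative parts, so that joint measurability in (v, n) is visible.\<close>
  define E where "E v n = exp_neg (enn2ereal (ennreal v * (\<integral>\<^sup>+ y. ennreal (F y) \<partial>mu h n)) -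
      enn2ereal (ennreal v * (\<integral>\<^sup>+ y. ennreal (- F y) \<partial>mu h n)))" for v n
  have E: "exp_neg (ext_integral (mu h n) (\<lambda>y. v * F y)) = E v n" if "0 \<le> v" for v n
    unfolding E_def using that by (subst ext_integral_cmult_eq) auto
  have [measurable]: "(\<lambda>x. E (fst x) (snd x)) \<in> borel_measurable (borel \<Otimes>\<^sub>M Q)"
    unfolding E_def by measurable
  have [measurable]: "E v \<in> borel_measurable Q" for v
    unfolding E_def[abs_def] by measurable
  define J where "J v = (\<integral>\<^sup>+ n. nexp (ennreal v * T n) * E v n \<partial>Q)" for v
  have [measurable]: "J \<in> borel_measurable borel"
    unfolding J_def[abs_def] by (rule Q.borel_measurable_nn_integral) (simp add: case_prod_beta')
  define K where "K v = laplace_functional (mu_law h (exp_tilt v h \<rho>) \<eta>) (\<lambda>y. v * F y)" for v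
  have ZK: "Z v * K v = J v" if "0 \<le> v" for v
    unfolding K_def J_def using that
    by (subst laplace_functional_mu_law_exp_tilt) (auto simp: E)
  then have K: "K v = J v / Z v" if "0 \<le> v" for v
    using that Z_neq[of v] by (metis mult.commute mult_divide_eq_ennreal)
  have K_meas: "K \<in> borel_measurable (restrict_space lborel {0<..})"
  proof -
    have "(\<lambda>v. J v / Z v) \<in> borel_measurable (restrict_space lborel {0<..})"
      by (intro measurable_restrict_space1) measurable
    then show ?thesis
      by (subst measurable_cong[where g = "\<lambda>v. J v / Z v"]) (auto simp: K space_restrict_space)
  qed
  define W where "W v n = ennreal (v powr (\<theta> - 1)) * (nexp (ennreal v * T n) * E v n) * indicator {0<..} v" for v :: real and n
  have inner: "AE n in Q. (\<integral>\<^sup>+ v. W v n \<partial>lborel) = ennreal (Gamma \<theta>) *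
      (neg_power \<theta> (enn2ereal (T n)) * neg_power \<theta> (1 + ext_integral (normalized_mu h n) F))"
    using T_finite AE_T_pos neg
  proof eventually_elim
    case (elim n)
    then obtain t where t: "T n = ennreal t" "0 < t" by (cases "T n") auto
    let ?P = "normalized_mu h n"
    define e where "e = ext_integral ?P F"
    have e: "e \<noteq> -\<infinity>"
      unfolding e_def using elim(3) by (rule ext_integral_neq_MInf)
    have sP [measurable_cong]: "sets ?P = sets borel" by (simp add: normalized_mu_def)
    \<comment> \<open>Here 0 < T < \<infinity> matters: only then is the normalization
      reversible.\<close>
    have mu: "mu h n = scale_measure (ennreal t) ?P"
    proof -
      have "ennreal t * inverse (ennreal t) = 1"
        using t by (simp add: inverse_ennreal flip: ennreal_mult)
      then show ?thesis by (simp add: normalized_mu_def t)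
    qed
    have ext: "ext_integral (mu h n) (\<lambda>y. v * F y) = ereal (t * v) * e" if "0 < v" for v
    proof -
      have "ext_integral (mu h n) (\<lambda>y. v * F y) = ext_integral ?P (\<lambda>y. (t * v) * F y)"
        unfolding mu using t by (subst ext_integral_scale_measure) (auto simp: mult.assoc)
      also have "\<dots> = ereal (t * v) * e"
        unfolding e_def using t that elim(3) by (intro ext_integral_cmult) auto
      finally show ?thesis .
    qed
    have "W v n = ennreal (v powr (\<theta> - 1)) * exp_neg (ereal v * (ereal t * (1 + e))) * indicator {0<..} v" for v
    proof (cases "0 < v")
      case True
      \<comment> \<open>The value e = \<infinity> is possible and harmless: v and t are positive, so
        both sides are infinite.\<close>
      have "ereal v * (ereal t * (1 + e)) = ereal (v * t) + ereal (t * v) * e"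
        using e True t by (cases e) (auto simp: algebra_simps one_ereal_def)
      then have "exp_neg (ereal v * (ereal t * (1 + e))) = ennreal (exp (- (v * t))) * exp_neg (ereal (t * v) * e)"
        by (simp only: exp_neg_add)
      moreover have "nexp (ennreal v * T n) = ennreal (exp (- (v * t)))"
        using True t by (simp add: nexp_ennreal flip: ennreal_mult)
      moreover have "E v n = exp_neg (ereal (t * v) * e)"
        using E[of v n] ext[OF True] True by simp
      ultimately show ?thesis by (simp add: W_def)
    qed (simp add: W_def)
    then have "(\<integral>\<^sup>+ v. W v n \<partial>lborel) = ennreal (Gamma \<theta>) * neg_power \<theta> (ereal t * (1 + e))"
      by (simp only: Gamma_mult_neg_power[OF \<theta>])
    moreover have "neg_power \<theta> (ereal t * (1 + e)) = neg_power \<theta> (ereal t) * neg_power \<theta> (1 + e)"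
      using t e by (intro neg_power_mult[symmetric]) (auto simp: one_ereal_def)
    ultimately show ?case
      using t by (simp add: e_def)
  qed
  interpret lQ: pair_sigma_finite lborel Q ..
  have ext_meas [measurable]: "(\<lambda>n. ext_integral (normalized_mu h n) F) \<in> borel_measurable Q"
    using measurable_compose[OF measurable_normalized_mu[OF h(1)] measurable_ext_integral(2)[OF F]]
    by (simp cong: measurable_cong_sets add: sets_law)
  have "(\<integral>\<^sup>+ v. K v \<partial>pi_law h \<rho> \<eta> \<theta>) =
      (\<integral>\<^sup>+ v. ennreal (v powr (\<theta> - 1)) * (Z v * K v) * indicator {0<..} v \<partial>lborel) / (ennreal (Gamma \<theta>) * ?m)"
    by (rule nn_integral_pi_law[OF K_meas])
  also have "(\<integral>\<^sup>+ v. ennreal (v powr (\<theta> - 1)) * (Z v * K v) * indicator {0<..} v \<partial>lborel) =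
      (\<integral>\<^sup>+ v. \<integral>\<^sup>+ n. W v n \<partial>Q \<partial>lborel)"
  proof (rule nn_integral_cong)
    fix v :: real
    have "(\<integral>\<^sup>+ n. W v n \<partial>Q) = ennreal (v powr (\<theta> - 1)) * J v * indicator {0<..} v"
      unfolding W_def J_def by (subst nn_integral_multc, measurable)+ (subst nn_integral_cmult, measurable)
    then show "ennreal (v powr (\<theta> - 1)) * (Z v * K v) * indicator {0<..} v = (\<integral>\<^sup>+ n. W v n \<partial>Q)"
      using ZK[of v] by (auto simp: indicator_def)
  qed
  \<comment> \<open>The integrand is nonnegative and \<open>Q\<close> is a probability, so the order
    may be exchanged without an integrability condition.\<close>
  also have "\<dots> = (\<integral>\<^sup>+ n. \<integral>\<^sup>+ v. W v n \<partial>lborel \<partial>Q)"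
    unfolding W_def by (intro lQ.Fubini'[symmetric]) (simp add: case_prod_beta')
  also have "\<dots> = (\<integral>\<^sup>+ n. ennreal (Gamma \<theta>) *
      (neg_power \<theta> (enn2ereal (T n)) * neg_power \<theta> (1 + ext_integral (normalized_mu h n) F)) \<partial>Q)"
    using inner by (rule nn_integral_cong_AE)
  also have "\<dots> = ennreal (Gamma \<theta>) *
      (\<integral>\<^sup>+ n. neg_power \<theta> (enn2ereal (T n)) * neg_power \<theta> (1 + ext_integral (normalized_mu h n) F) \<partial>Q)"
    by (rule nn_integral_cmult) measurable
  also have "\<dots> / (ennreal (Gamma \<theta>) * ?m) =
      (\<integral>\<^sup>+ n. neg_power \<theta> (enn2ereal (T n)) * neg_power \<theta> (1 + ext_integral (normalized_mu h n) F) \<partial>Q) / ?m"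
    using G by (simp add: mult.commute[of "ennreal (Gamma \<theta>)"] divide_mult_eq)
  also have "\<dots> = (\<integral>\<^sup>+ n. neg_power \<theta> (enn2ereal (T n)) * neg_power \<theta> (1 + ext_integral (normalized_mu h n) F) / ?m \<partial>Q)"
    by (rule nn_integral_divide[symmetric]) measurable
  finally show ?thesis
    unfolding K_def by (simp add: divide_ennreal_def mult_ac)
qed

lemma nn_integral_P_tilde:
  assumes u: "u \<in> borel_measurable (subprob_algebra borel)"
  shows "(\<integral>\<^sup>+ P. u P \<partial>P_tilde h \<rho> \<eta> \<theta>) =
    (\<integral>\<^sup>+ n. neg_power \<theta> (enn2ereal (T n)) / T_moment h \<rho> \<eta> \<theta> * u (normalized_mu h n) \<partial>Q)"
proof -
  have [measurable]: "normalized_mu h \<in> Q \<rightarrow>\<^sub>M subprob_algebra borel"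
    using measurable_normalized_mu[OF h(1)] by (simp cong: measurable_cong_sets add: sets_law)
  have [measurable]: "(\<lambda>n. u (normalized_mu h n)) \<in> borel_measurable Q"
    using u by measurable
  show ?thesis
    unfolding P_tilde_def using u by (subst nn_integral_distr) (auto simp: nn_integral_density)
qed

text \<open>The weight T^{-\<theta>} / E[T^{-\<theta>}] is positive for \<open>Q\<close>-almost
  every realization, since T is finite and so is the moment. Hence a null set of the weighted law is
  already null under \<open>Q\<close>.\<close>

lemma AE_P_tilde:
  assumes "AE P in P_tilde h \<rho> \<eta> \<theta>. R P"
  shows "AE n in Q. R (normalized_mu h n)"
proof -
  have [measurable]: "normalized_mu h \<in> Q \<rightarrow>\<^sub>M subprob_algebra borel"
    using measurable_normalized_mu[OF h(1)] by (simp cong: measurable_cong_sets add: sets_law)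
  have "AE n in density Q (\<lambda>n. neg_power \<theta> (enn2ereal (T n)) / T_moment h \<rho> \<eta> \<theta>). R (normalized_mu h n)"
    using assms unfolding P_tilde_def by (rule AE_distrD[rotated]) measurable
  then have "AE n in Q. 0 < neg_power \<theta> (enn2ereal (T n)) / T_moment h \<rho> \<eta> \<theta> \<longrightarrow> R (normalized_mu h n)"
    by (subst (asm) AE_density) auto
  with T_finite AE_T_pos show ?thesis
  proof eventually_elim
    case (elim n)
    then obtain t where "T n = ennreal t" "0 < t" by (cases "T n") auto
    then have "0 < neg_power \<theta> (enn2ereal (T n))" by (simp add: neg_power_def)
    with elim moment_finite show ?case by (simp add: ennreal_zero_less_divide)
  qed
qed

end

end

theorem proposition6p1:
  fixes \<rho> :: "'y::polish_space \<Rightarrow> 's::polish_space measure"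
    and \<eta> :: "'y measure"
    and h :: "'s \<Rightarrow> real"
    and \<Omega> :: "'w measure"
    and N :: "'w \<Rightarrow> ('s \<times> 'y) measure"
    and \<theta> :: real
    and q :: nat
    and f :: "nat \<Rightarrow> 'y \<Rightarrow> real"
    and z :: "nat \<Rightarrow> real"
  assumes eta_sets: "sets \<eta> = sets borel"
    and eta_sigma_finite: "sigma_finite_measure \<eta>"
    and eta_non_atomic: "non_atomic \<eta>"
    and rho: "levy_kernel \<rho>"
    and h_measurable: "h \<in> borel_measurable borel"
    and h_pos: "\<And>s. h s > 0"
    and N_poisson: "poisson_random_measure \<Omega> N (intensity \<rho> \<eta>)"
    and T_finite: "AE w in \<Omega>. total_mass h (N w) < \<infinity>"
    and theta_pos: "\<theta> > 0"
    and T_moment_finite: "T_moment h \<rho> \<eta> \<theta> < \<infinity>"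
    and f_measurable: "\<And>l. l \<in> {1..q} \<Longrightarrow> f l \<in> borel_measurable borel"
    and Pf_defined:
      "\<And>l. l \<in> {1..q} \<Longrightarrow>
         AE P in P_tilde h \<rho> \<eta> \<theta>. (\<integral>\<^sup>+ y. ennreal (- f l y) \<partial>P) < \<infinity>"
    and z_nonneg: "\<And>l. l \<in> {1..q} \<Longrightarrow> z l \<ge> 0"
  shows
    "(\<integral>\<^sup>+ P. neg_power \<theta> (1 + (\<Sum>l=1..q. ereal (z l) * ext_integral P (f l)))
        \<partial>P_tilde h \<rho> \<eta> \<theta>)
       = laplace_functional (V_mu_V_law h \<rho> \<eta> \<theta>) (\<lambda>y. \<Sum>l=1..q. z l * f l y)
     \<and> laplace_functional (V_mu_V_law h \<rho> \<eta> \<theta>) (\<lambda>y. \<Sum>l=1..q. z l * f l y)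
       = (\<integral>\<^sup>+ v. laplace_functional (mu_law h (exp_tilt v h \<rho>) \<eta>)
                    (\<lambda>y. v * (\<Sum>l=1..q. z l * f l y))
            \<partial>pi_law h \<rho> \<eta> \<theta>)"
proof -
  let ?L = "intensity \<rho> \<eta>"
  note sf = sigma_finite_intensity[OF eta_sets eta_sigma_finite rho]
  have [measurable]: "total_mass h \<in> borel_measurable (measure_algebra (borel \<Otimes>\<^sub>M borel :: ('s \<times> 'y) measure))"
    by (rule measurable_total_mass[OF h_measurable])
  \<comment> \<open>The given \<open>N\<close> supplies the existence behind
    \<open>P_law \<rho> \<eta>\<close>: that law is the image of \<Omega> under
    \<open>N\<close>.\<close>
  note law = poisson_law_eq_distr[OF N_poisson sf, folded P_law_def]
  have ma: "measure_algebra ?L = measure_algebra (borel \<Otimes>\<^sub>M borel)"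
    by (rule measure_algebra_cong) simp
  have N: "N \<in> \<Omega> \<rightarrow>\<^sub>M measure_algebra (borel \<Otimes>\<^sub>M borel)"
    using N_poisson unfolding ma[symmetric] by (simp add: poisson_random_measure_def)
  interpret normalized_poisson \<rho> \<eta> h
  proof (rule normalized_poisson.intro)
    show "poisson_laplace (P_law \<rho> \<eta>) (\<lambda>n. n) ?L"
      unfolding law by (rule poisson_laplace.poisson_laplace_distr[OF poisson_random_measure_laplace[OF N_poisson sf]])
    show "sets (P_law \<rho> \<eta>) = sets (measure_algebra (borel \<Otimes>\<^sub>M borel))"
      by (simp add: law ma)
    show "AE n in P_law \<rho> \<eta>. total_mass h n < \<infinity>"
      unfolding law ma using N T_finite by (subst AE_distr_iff) auto
  qed fact+
  define F where "F y = (\<Sum>l=1..q. z l * f l y)" for y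
  have F: "F \<in> borel_measurable borel"
    unfolding F_def[abs_def] using f_measurable by (intro borel_measurable_sum borel_measurable_times) auto
  \<comment> \<open>The hypothesis on the f_l is stated under the law of P, whereas linearity is
    used for realizations under \<open>Q\<close>.\<close>
  have "AE n in Q. \<forall>l\<in>{1..q}. (\<integral>\<^sup>+ y. ennreal (- f l y) \<partial>normalized_mu h n) < \<infinity>"
    using AE_P_tilde[OF theta_pos T_moment_finite Pf_defined] by (intro AE_finite_allI) auto
  then have AE: "AE n in Q. ext_integral (normalized_mu h n) F =
        (\<Sum>l=1..q. ereal (z l) * ext_integral (normalized_mu h n) (f l)) \<and>
      (\<integral>\<^sup>+ y. ennreal (- F y) \<partial>normalized_mu h n) < \<infinity>"
  proof eventually_elim
    case (elim n)
    have "f l \<in> borel_measurable (normalized_mu h n)" if "l \<in> {1..q}" for l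
      using f_measurable[OF that] by (simp add: normalized_mu_def cong: measurable_cong_sets)
    then show ?case
      unfolding F_def[abs_def] using elim z_nonneg by (intro ext_integral_sum) auto
  qed
  have "(\<lambda>P. neg_power \<theta> (1 + (\<Sum>l=1..q. ereal (z l) * ext_integral P (f l))))
      \<in> borel_measurable (subprob_algebra borel)"
    using measurable_ext_integral(2)[OF f_measurable]
    by (intro borel_measurable_neg_power borel_measurable_ereal_add borel_measurable_ereal_sum
        borel_measurable_ereal_times) auto
  then have "(\<integral>\<^sup>+ P. neg_power \<theta> (1 + (\<Sum>l=1..q. ereal (z l) * ext_integral P (f l))) \<partial>P_tilde h \<rho> \<eta> \<theta>) =
      (\<integral>\<^sup>+ n. neg_power \<theta> (enn2ereal (T n)) / T_moment h \<rho> \<eta> \<theta> *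
        neg_power \<theta> (1 + (\<Sum>l=1..q. ereal (z l) * ext_integral (normalized_mu h n) (f l))) \<partial>Q)"
    by (rule nn_integral_P_tilde[OF theta_pos T_moment_finite])
  \<comment> \<open>Finite negative parts make the sum of the z_l Pf_l equal to PF almost surely,
    which reduces the q functions to the single function \<open>F\<close>.\<close>
  also have "\<dots> = (\<integral>\<^sup>+ n. neg_power \<theta> (enn2ereal (T n)) / T_moment h \<rho> \<eta> \<theta> *
        neg_power \<theta> (1 + ext_integral (normalized_mu h n) F) \<partial>Q)"
    using AE by (intro nn_integral_cong_AE) (auto elim!: eventually_mono)
  also have "\<dots> = (\<integral>\<^sup>+ v. laplace_functional (mu_law h (exp_tilt v h \<rho>) \<eta>) (\<lambda>y. v * F y) \<partial>pi_law h \<rho> \<eta> \<theta>)"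
    using AE by (intro mixture_representation[OF theta_pos T_moment_finite F]) (auto elim!: eventually_mono)
  finally show ?thesis
    using laplace_functional_V_mu_V_law[OF F, of \<theta>] by (simp add: F_def[abs_def])
qed

end
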